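(* Let $K$ be a field, $Q$ a finite quiver, $\mathcal B$ the set of finite directed paths of $Q$, $\succ$ an admissible order on $\mathcal B$, and $\mathcal T\subset\mathcal B$ a tip-reduced set of paths of length at least $2$. Then there is a one-to-one correspondence between the sets $\mathrm{Alg}_{\mathcal T}$ and $\mathcal V_{\mathcal T}$.
   Context: Vertices of $Q$ are regarded as paths of length $0$ in $\mathcal B$; paths are read left to right. For $p,q\in\mathcal B$, $p$ is a subpath of $q$ if $q=rps$ for some $r,s\in\mathcal B$. An admissible order $\succ$ on $\mathcal B$ is a well-order such that: if $p\succ q$ then $pr\succ qr$ whenever $pr,qr$ are nonzero, and $sp\succ sq$ whenever $sp,sq$ are nonzero; and if $p=rqs\neq0$ then $p\succeq q$. For $0\ne x=\sum_p\alpha_pp\in KQ$, $\mathrm{tip}(x)$ is the $\succ$-largest $p$ with $\alpha_p\neq0$; $\mathrm{tip}(X)=\{\mathrm{tip}(x)\mid 0\neq x\in X\}$. A set $X$ is tip-reduced if for distinct nonzero $x,y\in X$, $\mathrm{tip}(x)$ is not a subpath of $\mathrm{tip}(y)$. Paths are parallel, $p\|q$, if they have the same origin and the same terminus vertices. All ideals are two-sided. For an ideal $I$ put $I_{Mon}=\langle\mathrm{tip}(I)\rangle$. There is a unique minimal set $\mathcal T_I$ of paths generating $I_{Mon}$, and for each $t\in\mathcal T_I$ there is a unique $g_t\in I$ with $t-g_t\in\mathrm{Span}_K(\mathcal B\setminus\mathrm{tip}(I))$; the set $\{g_t\mid t\in\mathcal T_I\}$ is the reduced Gröbner basis of $I$.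 $\mathrm{Alg}_{\mathcal T}=\{KQ/I\mid I\text{ an ideal of }KQ\text{ with }I_{Mon}=\langle\mathcal T\rangle\}$. Let $\mathcal N$ be the set of paths having no element of $\mathcal T$ as a subpath, and for $t\in\mathcal T$ let $\mathcal N(t)=\{n\in\mathcal N\mid n\|t,\ t\succ n\}$. Let $K^D$ denote the set of arrays $\mathbf c=(c_{t,n})$ ($t\in\mathcal T$, $n\in\mathcal N(t)$) of elements of $K$ such that for each $t$ only finitely many $c_{t,n}$ are nonzero. For such $\mathbf c$ let $\mathcal G_{\mathbf c}=\{t-\sum_{n\in\mathcal N(t)}c_{t,n}n\mid t\in\mathcal T\}$. Then $\mathcal V_{\mathcal T}=\{\mathbf c\in K^D\mid \mathcal G_{\mathbf c}\text{ is the reduced Gröbner basis of }\langle\mathcal G_{\mathbf c}\rangle\}$. *)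

theory Defs
  imports
    "Graph_Theory.Arc_Walk"
    "HOL-Algebra.QuotRing"
    "HOL-Algebra.Module"
begin

section \<open>Paths of a quiver\<close>

text \<open>
  A quiver is a directed multigraph, loops allowed.  A path is a pair of its origin and its list of
  arrows, read from left to right; the pair of a vertex and the empty list is the path of length 0
  at that vertex.
\<close>

type_synonym ('v, 'a) qpath = "'v \<times> 'a list"

definition qpaths :: "('v, 'a) pre_digraph \<Rightarrow> ('v, 'a) qpath set" where
  "qpaths Q = {p. \<exists>v. pre_digraph.awalk Q (fst p) (snd p) v}"

definition origin :: "('v, 'a) qpath \<Rightarrow> 'v" where
  "origin p = fst p"

definition terminus :: "('v, 'a) pre_digraph \<Rightarrow> ('v, 'a) qpath \<Rightarrow> 'v" where
  "terminus Q p = pre_digraph.awlast Q (fst p) (snd p)"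

definition qlength :: "('v, 'a) qpath \<Rightarrow> nat" where
  "qlength p = length (snd p)"

definition parallel :: "('v, 'a) pre_digraph \<Rightarrow> ('v, 'a) qpath \<Rightarrow> ('v, 'a) qpath \<Rightarrow> bool" where
  "parallel Q p q \<longleftrightarrow> origin p = origin q \<and> terminus Q p = terminus Q q"

text \<open>
  The product of the paths \<open>p\<close> and \<open>q\<close> in the path algebra is nonzero iff \<open>composable Q p q\<close>, and
  then it is the path \<open>concat_path p q\<close>.
\<close>

definition composable :: "('v, 'a) pre_digraph \<Rightarrow> ('v, 'a) qpath \<Rightarrow> ('v, 'a) qpath \<Rightarrow> bool" where
  "composable Q p q \<longleftrightarrow> terminus Q p = origin q"

definition concat_path :: "('v, 'a) qpath \<Rightarrow> ('v, 'a) qpath \<Rightarrow> ('v, 'a) qpath" where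
  "concat_path p q = (fst p, snd p @ snd q)"

definition subpath :: "('v, 'a) pre_digraph \<Rightarrow> ('v, 'a) qpath \<Rightarrow> ('v, 'a) qpath \<Rightarrow> bool" where
  "subpath Q p q \<longleftrightarrow> (\<exists>r\<in>qpaths Q. \<exists>s\<in>qpaths Q.
     composable Q r p \<and> composable Q (concat_path r p) s \<and> q = concat_path (concat_path r p) s)"

text \<open>
  An order is given by its reflexive relation \<open>R\<close>: \<open>(q, p) \<in> R\<close> means that \<open>p\<close> is at least \<open>q\<close>.
\<close>

definition greater :: "('v, 'a) qpath rel \<Rightarrow> ('v, 'a) qpath \<Rightarrow> ('v, 'a) qpath \<Rightarrow> bool" where
  "greater R p q \<longleftrightarrow> (q, p) \<in> R \<and> p \<noteq> q"

definition admissible_order :: "('v, 'a) pre_digraph \<Rightarrow> ('v, 'a) qpath rel \<Rightarrow> bool" where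
  "admissible_order Q R \<longleftrightarrow>
     well_order_on (qpaths Q) R \<and>
     (\<forall>p\<in>qpaths Q. \<forall>q\<in>qpaths Q. \<forall>r\<in>qpaths Q.
        greater R p q \<and> composable Q p r \<and> composable Q q r \<longrightarrow>
        greater R (concat_path p r) (concat_path q r)) \<and>
     (\<forall>p\<in>qpaths Q. \<forall>q\<in>qpaths Q. \<forall>s\<in>qpaths Q.
        greater R p q \<and> composable Q s p \<and> composable Q s q \<longrightarrow>
        greater R (concat_path s p) (concat_path s q)) \<and>
     (\<forall>p\<in>qpaths Q. \<forall>q\<in>qpaths Q. subpath Q q p \<longrightarrow> (q, p) \<in> R)"


section \<open>The path algebra and its quotients\<close>

text \<open>
  An element of \<open>KQ\<close> is the function assigning to each path its coefficient.
\<close>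

definition path_algebra ::
  "('v, 'a) pre_digraph \<Rightarrow> ('k::field, ('v, 'a) qpath \<Rightarrow> 'k) module" where
  "path_algebra Q =
    \<lparr>carrier = {x. finite {p. x p \<noteq> 0} \<and> {p. x p \<noteq> 0} \<subseteq> qpaths Q},
     mult = (\<lambda>x y r. \<Sum>(p, q) \<in> {(p, q). p \<in> qpaths Q \<and> q \<in> qpaths Q \<and> composable Q p q \<and>
                                          concat_path p q = r}. x p * y q),
     one = (\<lambda>p. if p \<in> qpaths Q \<and> qlength p = 0 then 1 else 0),
     zero = (\<lambda>p. 0),
     add = (\<lambda>x y p. x p + y p),
     smult = (\<lambda>a x p. a * x p)\<rparr>"

definition path_elem :: "('v, 'a) qpath \<Rightarrow> ('v, 'a) qpath \<Rightarrow> 'k::field" where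
  "path_elem p = (\<lambda>q. if q = p then 1 else 0)"

definition path_span ::
  "('v, 'a) pre_digraph \<Rightarrow> ('v, 'a) qpath set \<Rightarrow> (('v, 'a) qpath \<Rightarrow> 'k::field) set" where
  "path_span Q S = {x \<in> carrier (path_algebra Q). {p. x p \<noteq> 0} \<subseteq> S}"

text \<open>
  The library's quotient ring \<open>A Quot I\<close> of cosets, together with the scalar multiplication
  \<open>k (I + x) = I + k x\<close>.
\<close>

definition quotient_algebra :: "('k, 'b) module \<Rightarrow> 'b set \<Rightarrow> ('k, 'b set) module" where
  "quotient_algebra A I =
    \<lparr>carrier = carrier (A Quot I), mult = mult (A Quot I), one = one (A Quot I),
     zero = zero (A Quot I), add = add (A Quot I),
     smult = (\<lambda>k X. \<Union>x\<in>X. I +>\<^bsub>A\<^esub> (k \<odot>\<^bsub>A\<^esub> x))\<rparr>"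


section \<open>Tips and reduced Groebner bases\<close>

definition tip :: "('v, 'a) qpath rel \<Rightarrow> (('v, 'a) qpath \<Rightarrow> 'k::field) \<Rightarrow> ('v, 'a) qpath" where
  "tip R x = (THE p. x p \<noteq> 0 \<and> (\<forall>q. x q \<noteq> 0 \<longrightarrow> (q, p) \<in> R))"

definition tips ::
  "('v, 'a) pre_digraph \<Rightarrow> ('v, 'a) qpath rel \<Rightarrow> (('v, 'a) qpath \<Rightarrow> 'k::field) set \<Rightarrow>
    ('v, 'a) qpath set" where
  "tips Q R X = tip R ` (X - {\<zero>\<^bsub>path_algebra Q\<^esub>})"

definition tip_reduced ::
  "('v, 'a) pre_digraph \<Rightarrow> ('v, 'a) qpath rel \<Rightarrow> (('v, 'a) qpath \<Rightarrow> 'k::field) set \<Rightarrow> bool" where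
  "tip_reduced Q R X \<longleftrightarrow>
     (\<forall>x \<in> X - {\<zero>\<^bsub>path_algebra Q\<^esub>}. \<forall>y \<in> X - {\<zero>\<^bsub>path_algebra Q\<^esub>}.
        x \<noteq> y \<longrightarrow> \<not> subpath Q (tip R x) (tip R y))"

text \<open>The ideal generated by a set of paths.\<close>

definition monomial_ideal ::
  "('v, 'a) pre_digraph \<Rightarrow> ('v, 'a) qpath set \<Rightarrow> (('v, 'a) qpath \<Rightarrow> 'k::field) set" where
  "monomial_ideal Q S = Idl\<^bsub>path_algebra Q\<^esub> (path_elem ` S)"

definition I_Mon ::
  "('v, 'a) pre_digraph \<Rightarrow> ('v, 'a) qpath rel \<Rightarrow> (('v, 'a) qpath \<Rightarrow> 'k::field) set \<Rightarrow>
    (('v, 'a) qpath \<Rightarrow> 'k) set" where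
  "I_Mon Q R I = monomial_ideal Q (tips Q R I)"

definition min_tips ::
  "('v, 'a) pre_digraph \<Rightarrow> ('v, 'a) qpath rel \<Rightarrow> (('v, 'a) qpath \<Rightarrow> 'k::field) set \<Rightarrow>
    ('v, 'a) qpath set" where
  "min_tips Q R I =
    (THE S. S \<subseteq> qpaths Q \<and> monomial_ideal Q S = I_Mon Q R I \<and>
            (\<forall>S'. S' \<subset> S \<longrightarrow> monomial_ideal Q S' \<noteq> I_Mon Q R I))"

definition reduced_elem ::
  "('v, 'a) pre_digraph \<Rightarrow> ('v, 'a) qpath rel \<Rightarrow> (('v, 'a) qpath \<Rightarrow> 'k::field) set \<Rightarrow>
    ('v, 'a) qpath \<Rightarrow> ('v, 'a) qpath \<Rightarrow> 'k" where
  "reduced_elem Q R I t =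
    (THE g. g \<in> I \<and> path_elem t \<ominus>\<^bsub>path_algebra Q\<^esub> g \<in> path_span Q (qpaths Q - tips Q R I))"

definition reduced_groebner_basis ::
  "('v, 'a) pre_digraph \<Rightarrow> ('v, 'a) qpath rel \<Rightarrow> (('v, 'a) qpath \<Rightarrow> 'k::field) set \<Rightarrow>
    (('v, 'a) qpath \<Rightarrow> 'k) set" where
  "reduced_groebner_basis Q R I = reduced_elem Q R I ` min_tips Q R I"


section \<open>The sets \<open>Alg\<^sub>T\<close> and \<open>V\<^sub>T\<close>\<close>

text \<open>
  Members of \<open>Alg\<^sub>T\<close> are the quotients themselves and not isomorphism classes of algebras.
\<close>

definition Alg ::
  "('v, 'a) pre_digraph \<Rightarrow> ('v, 'a) qpath rel \<Rightarrow> ('v, 'a) qpath set \<Rightarrow>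
    ('k::field, (('v, 'a) qpath \<Rightarrow> 'k) set) module set" where
  "Alg Q R T = {quotient_algebra (path_algebra Q) I | I.
                  ideal I (path_algebra Q) \<and> I_Mon Q R I = monomial_ideal Q T}"

definition normal_paths ::
  "('v, 'a) pre_digraph \<Rightarrow> ('v, 'a) qpath set \<Rightarrow> ('v, 'a) qpath set" where
  "normal_paths Q T = {n \<in> qpaths Q. \<forall>t\<in>T. \<not> subpath Q t n}"

definition normal_below ::
  "('v, 'a) pre_digraph \<Rightarrow> ('v, 'a) qpath rel \<Rightarrow> ('v, 'a) qpath set \<Rightarrow> ('v, 'a) qpath \<Rightarrow>
    ('v, 'a) qpath set" where
  "normal_below Q R T t = {n \<in> normal_paths Q T. parallel Q n t \<and> greater R t n}"

text \<open>
  An array is a function on all pairs of paths which is 0 off its index set, so that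
  equality of functions is equality of arrays.
\<close>

definition arrays ::
  "('v, 'a) pre_digraph \<Rightarrow> ('v, 'a) qpath rel \<Rightarrow> ('v, 'a) qpath set \<Rightarrow>
    (('v, 'a) qpath \<Rightarrow> ('v, 'a) qpath \<Rightarrow> 'k::field) set" where
  "arrays Q R T = {c. (\<forall>t n. c t n \<noteq> 0 \<longrightarrow> t \<in> T \<and> n \<in> normal_below Q R T t) \<and>
                      (\<forall>t\<in>T. finite {n. c t n \<noteq> 0})}"

text \<open>
  As elements of \<open>KQ\<close> are coefficient functions, the linear combination of the paths
  \<open>n \<in> normal_below Q R T t\<close> with coefficients \<open>c t n\<close> is the function subtracted below.
\<close>

definition array_elems ::
  "('v, 'a) pre_digraph \<Rightarrow> ('v, 'a) qpath rel \<Rightarrow> ('v, 'a) qpath set \<Rightarrow>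
    (('v, 'a) qpath \<Rightarrow> ('v, 'a) qpath \<Rightarrow> 'k::field) \<Rightarrow> (('v, 'a) qpath \<Rightarrow> 'k) set" where
  "array_elems Q R T c =
    {path_elem t \<ominus>\<^bsub>path_algebra Q\<^esub> (\<lambda>n. if n \<in> normal_below Q R T t then c t n else 0) | t. t \<in> T}"

definition array_ideal ::
  "('v, 'a) pre_digraph \<Rightarrow> ('v, 'a) qpath rel \<Rightarrow> ('v, 'a) qpath set \<Rightarrow>
    (('v, 'a) qpath \<Rightarrow> ('v, 'a) qpath \<Rightarrow> 'k::field) \<Rightarrow> (('v, 'a) qpath \<Rightarrow> 'k) set" where
  "array_ideal Q R T c = Idl\<^bsub>path_algebra Q\<^esub> (array_elems Q R T c)"

definition V ::
  "('v, 'a) pre_digraph \<Rightarrow> ('v, 'a) qpath rel \<Rightarrow> ('v, 'a) qpath set \<Rightarrow>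
    (('v, 'a) qpath \<Rightarrow> ('v, 'a) qpath \<Rightarrow> 'k::field) set" where
  "V Q R T = {c \<in> arrays Q R T.
                array_elems Q R T c = reduced_groebner_basis Q R (array_ideal Q R T c)}"

end

theory Submission
  imports Defs
begin

text \<open>
  The theorem says that an ideal \<open>I\<close> of \<open>KQ\<close> with \<open>I\<^sub>M\<^sub>o\<^sub>n = \<langle>T\<rangle>\<close> and its reduced Groebner basis carry
  the same information, and that the basis is the same thing as an array in \<open>V\<close>.

  Everything rests on division with remainder by tips.  The tips of an ideal \<open>I\<close> are closed under
  passing to paths that contain them, since multiplying by a path preserves the order and is injective
  on the paths that it does not kill, so the tip of \<open>r x s\<close> is \<open>r tip(x) s\<close> whenever the latter is
  nonzero (\<open>tips_upward_closed\<close>).  Subtracting multiples of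
  elements of \<open>I\<close> to remove tips is a process that terminates because the order is a well-order, and
  it shows that modulo \<open>I\<close> every element is congruent to a combination of paths outside \<open>tip(I)\<close>
  (\<open>normal_form_exists\<close>); the combination is unique because a nonzero element of \<open>I\<close> has its tip
  in \<open>tip(I)\<close> (\<open>ideal_Int_nontips\<close>).  Applied to a path \<open>t\<close> this gives the reduced element \<open>g\<^sub>t\<close>.  Its
  tip is \<open>t\<close> when \<open>t\<close> is a tip of \<open>I\<close>, and by uniqueness it only involves paths parallel to \<open>t\<close>
  (\<open>reduced_elem_parallel\<close>).

  A monomial ideal consists of the elements supported on paths with a subpath in the generating set
  (\<open>monomial_ideal_iff\<close>).  Hence generating sets of paths are compared through the upward closed sets
  they span, and the unique minimal one for \<open>I\<^sub>M\<^sub>o\<^sub>n\<close> is the set of minimal tips of \<open>I\<close> in the subpath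
  order (\<open>min_tips_eq\<close>).  A tip-reduced \<open>T\<close> with \<open>I\<^sub>M\<^sub>o\<^sub>n = \<langle>T\<rangle>\<close> is an antichain with the same upward
  closure, so it is that set.

  Surjectivity (\<open>V_array_exists\<close>): if \<open>I\<^sub>M\<^sub>o\<^sub>n = \<langle>T\<rangle>\<close>, the coefficients of \<open>t - g\<^sub>t\<close> for \<open>t \<in> T\<close> form an
  array, and the elements \<open>g\<^sub>t\<close> generate \<open>I\<close> because the ideal they generate lies in \<open>I\<close> and already has
  all its tips (\<open>ideal_eq_of_tips\<close>).  Injectivity (\<open>V_array_unique\<close>): a quotient determines its ideal,
  the ideal determines its reduced Groebner basis, and the row of the array at \<open>t\<close> is read off from
  the basis element with tip \<open>t\<close>.
\<close>

lemma path_elem_apply [simp]: "path_elem p q = (if q = p then 1 else 0)"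
  by (simp add: path_elem_def)

locale ordered_quiver = fin_digraph Q
  for Q :: "('v, 'a) pre_digraph" +
  fixes R :: "('v, 'a) qpath rel"
  assumes admissible: "admissible_order Q R"
begin

abbreviation KQ :: "('k::field, ('v, 'a) qpath \<Rightarrow> 'k) module" where
  "KQ \<equiv> path_algebra Q"

(* A path is a pair; quantified paths are to be kept whole. *)
declare split_paired_All [simp del] split_paired_Ex [simp del]

section \<open>Paths\<close>

lemma concat_path_in_qpaths:
  "p \<in> qpaths Q \<Longrightarrow> q \<in> qpaths Q \<Longrightarrow> composable Q p q \<Longrightarrow> concat_path p q \<in> qpaths Q"
  by (auto simp: qpaths_def composable_def concat_path_def terminus_def origin_def
      intro: awalk_appendI)

lemma origin_concat_path [simp]: "origin (concat_path p q) = origin p"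
  by (simp add: origin_def concat_path_def)

lemma terminus_concat_path: "composable Q p q \<Longrightarrow> terminus Q (concat_path p q) = terminus Q q"
  by (simp add: composable_def terminus_def concat_path_def origin_def awlast_append)

lemma concat_path_assoc: "concat_path (concat_path p q) r = concat_path p (concat_path q r)"
  by (simp add: concat_path_def)

lemma trivial_path_in_qpaths [simp]: "(v, []) \<in> qpaths Q \<longleftrightarrow> v \<in> verts Q"
  by (auto simp: qpaths_def awalk_Nil_iff)

lemma origin_trivial_path [simp]: "origin (v, []) = v"
  by (simp add: origin_def)

lemma terminus_trivial_path [simp]: "terminus Q (v, []) = v"
  by (simp add: terminus_def)

lemma origin_in_verts: "p \<in> qpaths Q \<Longrightarrow> origin p \<in> verts Q"
  by (auto simp: qpaths_def origin_def)

lemma terminus_in_verts: "p \<in> qpaths Q \<Longrightarrow> terminus Q p \<in> verts Q"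
  by (auto simp: qpaths_def terminus_def)

lemma concat_trivial_left: "composable Q (v, []) p \<Longrightarrow> concat_path (v, []) p = p"
  by (cases p) (simp add: composable_def concat_path_def origin_def)

lemma concat_trivial_right [simp]: "concat_path p (v, []) = p"
  by (simp add: concat_path_def)

text \<open>
  A concatenation does not record the origin of its right factor; composability recovers it.
\<close>

lemma concat_left_cancel:
  "composable Q r p \<Longrightarrow> composable Q r q \<Longrightarrow> concat_path r p = concat_path r q \<Longrightarrow> p = q"
  by (auto simp: composable_def concat_path_def origin_def prod_eq_iff)

lemma concat_right_cancel: "concat_path p r = concat_path q r \<Longrightarrow> p = q"
  by (auto simp: concat_path_def prod_eq_iff)

lemma subpath_refl: "p \<in> qpaths Q \<Longrightarrow> subpath Q p p"
  unfolding subpath_def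
  by (rule bexI[of _ "(origin p, [])"], rule bexI[of _ "(terminus Q p, [])"])
    (auto simp: composable_def concat_trivial_left origin_in_verts terminus_in_verts)

lemma subpath_concat_left:
  assumes "r \<in> qpaths Q" "p \<in> qpaths Q" "composable Q r p"
  shows "subpath Q p (concat_path r p)"
  unfolding subpath_def
  by (rule bexI[OF _ assms(1)], rule bexI[of _ "(terminus Q p, [])"])
    (use assms in \<open>auto simp: composable_def terminus_concat_path terminus_in_verts\<close>)

lemma subpath_concat_right:
  assumes "s \<in> qpaths Q" "p \<in> qpaths Q" "composable Q p s"
  shows "subpath Q p (concat_path p s)"
  unfolding subpath_def
  by (rule bexI[of _ "(origin p, [])"], rule bexI[OF _ assms(1)])
    (use assms in \<open>auto simp: composable_def concat_trivial_left origin_in_verts\<close>)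

lemma subpath_trans:
  assumes "subpath Q p q" "subpath Q q w"
  shows "subpath Q p w"
proof -
  obtain r s where r: "r \<in> qpaths Q" "s \<in> qpaths Q" "composable Q r p"
      "composable Q (concat_path r p) s" "q = concat_path (concat_path r p) s"
    using assms(1) unfolding subpath_def by blast
  obtain r' s' where r': "r' \<in> qpaths Q" "s' \<in> qpaths Q" "composable Q r' q"
      "composable Q (concat_path r' q) s'" "w = concat_path (concat_path r' q) s'"
    using assms(2) unfolding subpath_def by blast
  have c: "composable Q r' r" "composable Q s s'"
    using r r' by (auto simp: composable_def terminus_concat_path)
  show ?thesis
    unfolding subpath_def
    by (rule bexI[of _ "concat_path r' r"], rule bexI[of _ "concat_path s s'"])
      (use r r' c in \<open>auto simp: composable_def terminus_concat_path concat_path_assoc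
          intro!: concat_path_in_qpaths\<close>)
qed

lemma subpath_length: "subpath Q p q \<Longrightarrow> qlength p \<le> qlength q"
  by (auto simp: subpath_def qlength_def concat_path_def)

text \<open>
  The outer factors have length 0, and composability makes them the trivial paths at the two ends.
\<close>

lemma subpath_eq_of_length:
  assumes "subpath Q p q" "qlength q \<le> qlength p"
  shows "p = q"
  using assms
  by (auto simp: subpath_def qlength_def concat_path_def composable_def origin_def terminus_def
      prod_eq_iff)

lemma subpath_antisym: "subpath Q p q \<Longrightarrow> subpath Q q p \<Longrightarrow> p = q"
  using subpath_eq_of_length subpath_length by blast

section \<open>The path algebra is a ring\<close>

definition splits :: "('v, 'a) qpath \<Rightarrow> (('v, 'a) qpath \<times> ('v, 'a) qpath) set" where
  "splits r = {(p, q). p \<in> qpaths Q \<and> q \<in> qpaths Q \<and> composable Q p q \<and> concat_path p q = r}"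

lemma splitsE:
  assumes "(p, q) \<in> splits r"
  obtains "p \<in> qpaths Q" "q \<in> qpaths Q" "composable Q p q" "r = concat_path p q"
  using assms by (auto simp: splits_def)

text \<open>
  A factorisation of a path is determined by the length of its left factor.
\<close>

lemma finite_splits: "finite (splits r)"
proof (rule finite_subset)
  let ?f = "\<lambda>i. ((fst r, take i (snd r)),
    (terminus Q (fst r, take i (snd r)), drop i (snd r)))"
  show "splits r \<subseteq> ?f ` {..length (snd r)}"
  proof safe
    fix u as v bs assume "((u, as), (v, bs)) \<in> splits r"
    then have "((u, as), (v, bs)) = ?f (length as)" "length as \<le> length (snd r)"
      by (auto simp: splits_def composable_def concat_path_def origin_def)
    then show "((u, as), (v, bs)) \<in> ?f ` {..length (snd r)}" by blast
  qed
qed simp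

lemma carrier_KQ:
  "x \<in> carrier KQ \<longleftrightarrow> finite {p. x p \<noteq> 0} \<and> {p. x p \<noteq> 0} \<subseteq> qpaths Q"
  by (simp add: path_algebra_def)

lemma mult_KQ: "(x \<otimes>\<^bsub>KQ\<^esub> y) r = (\<Sum>(p, q)\<in>splits r. x p * y q)"
  by (simp add: path_algebra_def splits_def)

lemma add_KQ: "x \<oplus>\<^bsub>KQ\<^esub> y = (\<lambda>p. x p + y p)"
  by (simp add: path_algebra_def)

lemma zero_KQ: "\<zero>\<^bsub>KQ\<^esub> = (\<lambda>p. 0)"
  by (simp add: path_algebra_def)

lemma one_KQ: "\<one>\<^bsub>KQ\<^esub> = (\<lambda>p. if p \<in> qpaths Q \<and> qlength p = 0 then 1 else 0)"
  by (simp add: path_algebra_def)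

lemma mult_KQ_support:
  assumes "(x \<otimes>\<^bsub>KQ\<^esub> y) r \<noteq> 0"
  obtains p q where "(p, q) \<in> splits r" "x p \<noteq> 0" "y q \<noteq> 0"
proof -
  have "\<exists>z\<in>splits r. (case z of (p, q) \<Rightarrow> x p * y q) \<noteq> 0"
    using assms unfolding mult_KQ by (meson sum.neutral)
  then show ?thesis using that by auto
qed

lemma carrier_KQ_linear:
  assumes "x \<in> carrier KQ" "y \<in> carrier KQ"
  shows "(\<lambda>p. a * x p + b * y p) \<in> carrier KQ"
proof -
  have "{p. a * x p + b * y p \<noteq> 0} \<subseteq> {p. x p \<noteq> 0} \<union> {p. y p \<noteq> 0}" by auto
  then show ?thesis
    using assms unfolding carrier_KQ by (meson finite_UnI finite_subset le_supI order_trans)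
qed

lemma path_elem_carrier [simp]: "path_elem p \<in> carrier KQ \<longleftrightarrow> p \<in> qpaths Q"
  by (auto simp: carrier_KQ)

lemma mult_KQ_closed:
  assumes "x \<in> carrier KQ" "y \<in> carrier KQ"
  shows "x \<otimes>\<^bsub>KQ\<^esub> y \<in> carrier KQ"
proof -
  have sub: "{r. (x \<otimes>\<^bsub>KQ\<^esub> y) r \<noteq> 0} \<subseteq>
      (\<lambda>(p, q). concat_path p q) ` ({p. x p \<noteq> 0} \<times> {q. y q \<noteq> 0}) \<inter> qpaths Q"
  proof safe
    fix u as assume "(x \<otimes>\<^bsub>KQ\<^esub> y) (u, as) \<noteq> 0"
    then obtain p q where "(p, q) \<in> splits (u, as)" "x p \<noteq> 0" "y q \<noteq> 0"
      by (rule mult_KQ_support)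
    then show "(u, as) \<in> (\<lambda>(p, q). concat_path p q) ` ({p. x p \<noteq> 0} \<times> {q. y q \<noteq> 0})"
      and "(u, as) \<in> qpaths Q"
      by (force elim!: splitsE simp: concat_path_in_qpaths)+
  qed
  have "finite ((\<lambda>(p, q). concat_path p q) ` ({p. x p \<noteq> 0} \<times> {q. y q \<noteq> 0}))"
    using assms by (simp add: carrier_KQ)
  then show ?thesis
    unfolding carrier_KQ using sub by (meson finite_Int finite_subset le_inf_iff)
qed

lemma splits_concat: "(p, q) \<in> splits r \<Longrightarrow> concat_path p q = r"
  by (auto elim: splitsE)

lemma splits_reassoc:
  shows "(p, q) \<in> splits r \<Longrightarrow> (p1, p2) \<in> splits p \<Longrightarrow> (p1, concat_path p2 q) \<in> splits r"
    and "(p, q) \<in> splits r \<Longrightarrow> (p1, p2) \<in> splits p \<Longrightarrow> (p2, q) \<in> splits (concat_path p2 q)"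
    and "(p, q) \<in> splits r \<Longrightarrow> (q1, q2) \<in> splits q \<Longrightarrow> (concat_path p q1, q2) \<in> splits r"
    and "(p, q) \<in> splits r \<Longrightarrow> (q1, q2) \<in> splits q \<Longrightarrow> (p, q1) \<in> splits (concat_path p q1)"
  by (elim splitsE, simp add: splits_def concat_path_in_qpaths composable_def
      terminus_concat_path concat_path_assoc)+

text \<open>Both bracketings sum over the factorisations of a path into three paths.\<close>

lemma mult_KQ_assoc: "(x \<otimes>\<^bsub>KQ\<^esub> y) \<otimes>\<^bsub>KQ\<^esub> z = x \<otimes>\<^bsub>KQ\<^esub> (y \<otimes>\<^bsub>KQ\<^esub> z)"
proof
  fix r
  have "((x \<otimes>\<^bsub>KQ\<^esub> y) \<otimes>\<^bsub>KQ\<^esub> z) r =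
      (\<Sum>i\<in>splits r. \<Sum>j\<in>splits (fst i). x (fst j) * y (snd j) * z (snd i))"
    by (simp add: mult_KQ sum_distrib_right case_prod_beta)
  also have "\<dots> = (\<Sum>(i, j)\<in>Sigma (splits r) (\<lambda>i. splits (fst i)).
      x (fst j) * y (snd j) * z (snd i))"
    by (rule sum.Sigma) (auto simp: finite_splits)
  also have "\<dots> = (\<Sum>(i, j)\<in>Sigma (splits r) (\<lambda>i. splits (snd i)).
      x (fst i) * y (fst j) * z (snd j))"
    by (rule sum.reindex_bij_witness[where
          i = "\<lambda>(i, j). ((concat_path (fst i) (fst j), snd j), (fst i, fst j))" and
          j = "\<lambda>(i, j). ((fst j, concat_path (snd j) (snd i)), (snd j, snd i))"])
      (auto simp: splits_reassoc dest: splits_concat)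
  also have "\<dots> = (\<Sum>i\<in>splits r. \<Sum>j\<in>splits (snd i). x (fst i) * y (fst j) * z (snd j))"
    by (rule sum.Sigma[symmetric]) (auto simp: finite_splits)
  also have "\<dots> = (x \<otimes>\<^bsub>KQ\<^esub> (y \<otimes>\<^bsub>KQ\<^esub> z)) r"
    by (simp add: mult_KQ sum_distrib_left case_prod_beta mult.assoc)
  finally show "((x \<otimes>\<^bsub>KQ\<^esub> y) \<otimes>\<^bsub>KQ\<^esub> z) r = (x \<otimes>\<^bsub>KQ\<^esub> (y \<otimes>\<^bsub>KQ\<^esub> z)) r" .
qed

text \<open>
  The identity is the sum of all trivial paths, and there are only finitely many vertices.
\<close>

lemma one_KQ_closed: "\<one>\<^bsub>KQ\<^esub> \<in> carrier KQ"
proof -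
  have "{p. p \<in> qpaths Q \<and> qlength p = 0} \<subseteq> (\<lambda>v. (v, [])) ` verts Q"
    by (auto simp: qlength_def)
  then have "finite {p. p \<in> qpaths Q \<and> qlength p = 0}"
    by (rule finite_subset) simp
  then show ?thesis by (simp add: carrier_KQ one_KQ)
qed

text \<open>
  Multiplication by a path only relabels coefficients: a path has at most one factorisation with a
  given left (or right) factor.
\<close>

lemma path_elem_mult_left:
  assumes "r \<in> qpaths Q" "q \<in> qpaths Q" "composable Q r q"
  shows "(path_elem r \<otimes>\<^bsub>KQ\<^esub> x) (concat_path r q) = x q"
proof -
  have "(path_elem r \<otimes>\<^bsub>KQ\<^esub> x) (concat_path r q) =
      (\<Sum>i\<in>splits (concat_path r q). if i = (r, q) then x q else 0)"
    unfolding mult_KQ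
    by (rule sum.cong)
      (use assms in \<open>auto elim!: splitsE dest: concat_left_cancel split: if_splits\<close>)
  then show ?thesis
    using assms by (simp add: finite_splits) (simp add: splits_def)
qed

lemma path_elem_mult_right:
  assumes "s \<in> qpaths Q" "q \<in> qpaths Q" "composable Q q s"
  shows "(x \<otimes>\<^bsub>KQ\<^esub> path_elem s) (concat_path q s) = x q"
proof -
  have "(x \<otimes>\<^bsub>KQ\<^esub> path_elem s) (concat_path q s) =
      (\<Sum>i\<in>splits (concat_path q s). if i = (q, s) then x q else 0)"
    unfolding mult_KQ
    by (rule sum.cong)
      (use assms in \<open>auto elim!: splitsE dest: concat_right_cancel split: if_splits\<close>)
  then show ?thesis
    using assms by (simp add: finite_splits) (simp add: splits_def)
qed

lemma path_elem_mult_left_support: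
  assumes "(path_elem r \<otimes>\<^bsub>KQ\<^esub> x) w \<noteq> 0"
  obtains q where "r \<in> qpaths Q" "q \<in> qpaths Q" "composable Q r q" "w = concat_path r q" "x q \<noteq> 0"
  using assms by (auto elim!: mult_KQ_support splitsE split: if_splits)

lemma path_elem_mult_right_support:
  assumes "(x \<otimes>\<^bsub>KQ\<^esub> path_elem s) w \<noteq> 0"
  obtains q where "s \<in> qpaths Q" "q \<in> qpaths Q" "composable Q q s" "w = concat_path q s" "x q \<noteq> 0"
  using assms by (auto elim!: mult_KQ_support splitsE split: if_splits)

lemma one_KQ_mult:
  assumes x: "x \<in> carrier KQ"
  shows "\<one>\<^bsub>KQ\<^esub> \<otimes>\<^bsub>KQ\<^esub> x = x" "x \<otimes>\<^bsub>KQ\<^esub> \<one>\<^bsub>KQ\<^esub> = x"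
proof -
  have *: "(\<one>\<^bsub>KQ\<^esub> \<otimes>\<^bsub>KQ\<^esub> x) r = x r \<and> (x \<otimes>\<^bsub>KQ\<^esub> \<one>\<^bsub>KQ\<^esub>) r = x r" for r
  proof (cases "r \<in> qpaths Q")
    case True
    have "(\<one>\<^bsub>KQ\<^esub> \<otimes>\<^bsub>KQ\<^esub> x) r = (\<Sum>i\<in>splits r. if i = ((origin r, []), r) then x r else 0)"
      unfolding mult_KQ one_KQ
      by (rule sum.cong)
        (auto elim!: splitsE simp: qlength_def concat_trivial_left composable_def split: if_splits)
    moreover have "((origin r, []), r) \<in> splits r"
      using True by (simp add: splits_def composable_def concat_trivial_left origin_in_verts)
    moreover have "(x \<otimes>\<^bsub>KQ\<^esub> \<one>\<^bsub>KQ\<^esub>) r =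
        (\<Sum>i\<in>splits r. if i = (r, (terminus Q r, [])) then x r else 0)"
      unfolding mult_KQ one_KQ
      by (rule sum.cong)
        (auto elim!: splitsE simp: qlength_def composable_def split: if_splits)
    moreover have "(r, (terminus Q r, [])) \<in> splits r"
      using True by (simp add: splits_def composable_def terminus_in_verts)
    ultimately show ?thesis by (simp add: finite_splits)
  next
    case False
    then have "splits r = {}" by (auto elim!: splitsE simp: concat_path_in_qpaths)
    moreover have "x r = 0" using x False by (auto simp: carrier_KQ)
    ultimately show ?thesis by (simp add: mult_KQ)
  qed
  then show "\<one>\<^bsub>KQ\<^esub> \<otimes>\<^bsub>KQ\<^esub> x = x" "x \<otimes>\<^bsub>KQ\<^esub> \<one>\<^bsub>KQ\<^esub> = x" by auto
qed

lemma ring_KQ: "ring (KQ :: ('k::field, ('v, 'a) qpath \<Rightarrow> 'k) module)"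
proof (rule ringI)
  let ?A = "KQ :: ('k, ('v, 'a) qpath \<Rightarrow> 'k) module"
  show "abelian_group ?A"
  proof (rule abelian_groupI)
    fix x y :: "('v, 'a) qpath \<Rightarrow> 'k" assume "x \<in> carrier ?A" "y \<in> carrier ?A"
    then show "x \<oplus>\<^bsub>?A\<^esub> y \<in> carrier ?A"
      using carrier_KQ_linear[of x y 1 1] by (simp add: add_KQ)
  next
    fix x :: "('v, 'a) qpath \<Rightarrow> 'k" assume "x \<in> carrier ?A"
    then show "\<exists>y\<in>carrier ?A. y \<oplus>\<^bsub>?A\<^esub> x = \<zero>\<^bsub>?A\<^esub>"
      using carrier_KQ_linear[of x x "-1" 0]
      by (intro bexI[of _ "\<lambda>p. - x p"]) (auto simp: add_KQ zero_KQ)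
  qed (auto simp: add_KQ zero_KQ carrier_KQ algebra_simps)
  show "monoid ?A"
    by (rule monoidI) (auto simp: mult_KQ_closed one_KQ_closed mult_KQ_assoc one_KQ_mult)
qed (auto simp: add_KQ mult_KQ algebra_simps sum.distrib case_prod_beta fun_eq_iff)

lemma a_inv_KQ:
  assumes "x \<in> carrier KQ"
  shows "\<ominus>\<^bsub>KQ\<^esub> x = (\<lambda>p. - x p)"
proof -
  interpret ring KQ by (rule ring_KQ)
  show ?thesis
    using carrier_KQ_linear[OF assms assms, of "-1" 0] assms
    by (intro minus_equality) (auto simp: add_KQ zero_KQ)
qed

lemma minus_KQ: "y \<in> carrier KQ \<Longrightarrow> x \<ominus>\<^bsub>KQ\<^esub> y = (\<lambda>p. x p - y p)"
  by (simp add: a_minus_def a_inv_KQ add_KQ)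

section \<open>The order, and tips\<close>

lemma
  shows order_refl: "p \<in> qpaths Q \<Longrightarrow> (p, p) \<in> R"
    and order_trans: "(p, q) \<in> R \<Longrightarrow> (q, w) \<in> R \<Longrightarrow> (p, w) \<in> R"
    and order_antisym: "(p, q) \<in> R \<Longrightarrow> (q, p) \<in> R \<Longrightarrow> p = q"
    and order_total: "p \<in> qpaths Q \<Longrightarrow> q \<in> qpaths Q \<Longrightarrow> (p, q) \<in> R \<or> (q, p) \<in> R"
    and wf_greater: "wf {(q, p). greater R p q}"
proof -
  have wo: "refl_on (qpaths Q) R" "trans R" "antisym R" "total_on (qpaths Q) R" "wf (R - Id)"
    using admissible
    by (auto simp: admissible_order_def well_order_on_def linear_order_on_def
        partial_order_on_def preorder_on_def)
  show refl: "p \<in> qpaths Q \<Longrightarrow> (p, p) \<in> R" for p using wo(1) by (auto simp: refl_on_def)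
  show "(p, q) \<in> R \<Longrightarrow> (q, w) \<in> R \<Longrightarrow> (p, w) \<in> R" using wo(2) by (rule transD)
  show "(p, q) \<in> R \<Longrightarrow> (q, p) \<in> R \<Longrightarrow> p = q" using wo(3) by (rule antisymD)
  show "p \<in> qpaths Q \<Longrightarrow> q \<in> qpaths Q \<Longrightarrow> (p, q) \<in> R \<or> (q, p) \<in> R"
    using wo(4) refl by (cases "p = q") (auto simp: total_on_def)
  have "{(q, p). greater R p q} = R - Id" by (auto simp: greater_def)
  then show "wf {(q, p). greater R p q}" using wo(5) by simp
qed

lemma greater_concat_left:
  assumes "greater R p q" "p \<in> qpaths Q" "q \<in> qpaths Q" "r \<in> qpaths Q"
    "composable Q r p" "composable Q r q"
  shows "greater R (concat_path r p) (concat_path r q)"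
  using admissible assms unfolding admissible_order_def by blast

lemma greater_concat_right:
  assumes "greater R p q" "p \<in> qpaths Q" "q \<in> qpaths Q" "s \<in> qpaths Q"
    "composable Q p s" "composable Q q s"
  shows "greater R (concat_path p s) (concat_path q s)"
  using admissible assms unfolding admissible_order_def by blast

lemma finite_paths_have_max:
  assumes "finite A" "A \<noteq> {}" "A \<subseteq> qpaths Q"
  shows "\<exists>p\<in>A. \<forall>q\<in>A. (q, p) \<in> R"
  using assms
proof (induction A rule: finite_ne_induct)
  case (singleton p)
  then show ?case by (simp add: order_refl)
next
  case (insert a A)
  then obtain p where p: "p \<in> A" "\<forall>q\<in>A. (q, p) \<in> R" by auto
  have a: "a \<in> qpaths Q" "p \<in> qpaths Q" using insert p by auto
  show ?case
  proof (cases "(a, p) \<in> R")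
    case True
    then show ?thesis using p by auto
  next
    case False
    then have "(p, a) \<in> R" using order_total a by blast
    then show ?thesis using p a order_refl order_trans by blast
  qed
qed

lemma tip_eqI:
  assumes "x p \<noteq> 0" "\<And>q. x q \<noteq> 0 \<Longrightarrow> (q, p) \<in> R"
  shows "tip R x = p"
  unfolding tip_def using assms order_antisym by (intro the_equality) blast+

lemma tip_nonzero:
  assumes "x \<in> carrier KQ" "x \<noteq> (\<lambda>p. 0)"
  shows "x (tip R x) \<noteq> 0"
    and "x q \<noteq> 0 \<Longrightarrow> (q, tip R x) \<in> R"
    and "tip R x \<in> qpaths Q"
proof -
  have "{p. x p \<noteq> 0} \<noteq> {}" using assms by auto
  then obtain p where p: "x p \<noteq> 0" "\<And>q. x q \<noteq> 0 \<Longrightarrow> (q, p) \<in> R"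
    using finite_paths_have_max[of "{p. x p \<noteq> 0}"] assms(1) unfolding carrier_KQ by blast
  have "tip R x = p" using p by (rule tip_eqI)
  then show "x (tip R x) \<noteq> 0" "x q \<noteq> 0 \<Longrightarrow> (q, tip R x) \<in> R" "tip R x \<in> qpaths Q"
    using p assms(1) by (auto simp: carrier_KQ)
qed

lemma tip_path_elem: "p \<in> qpaths Q \<Longrightarrow> tip R (path_elem p :: _ \<Rightarrow> 'k::field) = p"
  by (rule tip_eqI) (auto split: if_splits intro: order_refl)

lemma tips_iff: "p \<in> tips Q R I \<longleftrightarrow> (\<exists>x\<in>I. x \<noteq> (\<lambda>p. 0) \<and> tip R x = p)"
  by (auto simp: tips_def zero_KQ)

text \<open>
  Induction on the tip along the well-order: in the step the claim may be assumed for everything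
  supported strictly below the tip of \<open>x\<close>.  The element 0 has no tip and is a case of its own.
\<close>

lemma tip_induct [consumes 1, case_names zero reduce]:
  fixes x :: "('v, 'a) qpath \<Rightarrow> 'k::field"
  assumes "x \<in> carrier KQ"
    and "P (\<lambda>p. 0)"
    and "\<And>x. x \<in> carrier KQ \<Longrightarrow> x \<noteq> (\<lambda>p. 0) \<Longrightarrow>
      (\<And>y. y \<in> carrier KQ \<Longrightarrow> (\<And>q. y q \<noteq> 0 \<Longrightarrow> greater R (tip R x) q) \<Longrightarrow> P y) \<Longrightarrow> P x"
  shows "P x"
proof -
  have "\<forall>x\<in>carrier KQ. tip R x = t \<longrightarrow> P x" for t
  proof (induction t rule: wf_induct_rule[OF wf_greater])
    case (1 t)
    show ?case
    proof (intro ballI impI)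
      fix x :: "('v, 'a) qpath \<Rightarrow> 'k" assume x: "x \<in> carrier KQ" "tip R x = t"
      show "P x"
      proof (cases "x = (\<lambda>p. 0)")
        case False
        show ?thesis
        proof (rule assms(3)[OF x(1) False])
          fix y :: "('v, 'a) qpath \<Rightarrow> 'k"
          assume y: "y \<in> carrier KQ" "\<And>q. y q \<noteq> 0 \<Longrightarrow> greater R (tip R x) q"
          show "P y"
          proof (cases "y = (\<lambda>p. 0)")
            case False
            then show ?thesis using 1 y x(2) tip_nonzero(1)[OF y(1)] by blast
          qed (simp add: assms(2))
        qed
      qed (simp add: assms(2))
    qed
  qed
  then show ?thesis using assms(1) by blast
qed

text \<open>
  The reduction step of the division algorithm: the tips cancel, and all other paths in either
  support lie below.
\<close>

lemma cancel_tip: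
  assumes "x \<in> carrier KQ" "x \<noteq> (\<lambda>p. 0)" "y \<in> carrier KQ" "y \<noteq> (\<lambda>p. 0)" "tip R y = tip R x"
    and "x q - (x (tip R x) / y (tip R x)) * y q \<noteq> 0"
  shows "greater R (tip R x) q"
proof -
  have "x q \<noteq> 0 \<or> y q \<noteq> 0" using assms(6) by auto
  then have "(q, tip R x) \<in> R" 
    using tip_nonzero(2)[OF assms(1,2), of q] tip_nonzero(2)[OF assms(3,4), of q] assms(5)
    by metis
  moreover have "q \<noteq> tip R x" using assms(6) tip_nonzero(1)[OF assms(3,4)] assms(5) by auto
  ultimately show ?thesis by (simp add: greater_def)
qed

section \<open>Ideals\<close>

lemma ideal_subset: "ideal I KQ \<Longrightarrow> x \<in> I \<Longrightarrow> x \<in> carrier KQ"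
  by (rule ideal.Icarr)

text \<open>
  Ring ideals absorb scalars because the scalar \<open>a\<close> acts as multiplication by \<open>a 1\<close>.
\<close>

lemma ideal_smult:
  assumes "ideal I KQ" "x \<in> I"
  shows "(\<lambda>p. a * x p) \<in> I"
proof -
  interpret ideal I KQ by fact
  have x: "x \<in> carrier KQ" using assms by (rule ideal_subset)
  have "(\<lambda>p. a * \<one>\<^bsub>KQ\<^esub> p) \<in> carrier KQ"
    using carrier_KQ_linear[OF one_KQ_closed one_KQ_closed, of a 0] by simp
  then have "(\<lambda>p. a * \<one>\<^bsub>KQ\<^esub> p) \<otimes>\<^bsub>KQ\<^esub> x \<in> I" using assms(2) by (rule I_l_closed[rotated])
  moreover have "((\<lambda>p. a * \<one>\<^bsub>KQ\<^esub> p) \<otimes>\<^bsub>KQ\<^esub> x) = (\<lambda>r. a * x r)"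
  proof
    fix r
    have "((\<lambda>p. a * \<one>\<^bsub>KQ\<^esub> p) \<otimes>\<^bsub>KQ\<^esub> x) r = a * (\<one>\<^bsub>KQ\<^esub> \<otimes>\<^bsub>KQ\<^esub> x) r"
      by (simp add: mult_KQ sum_distrib_left case_prod_beta mult.assoc)
    then show "((\<lambda>p. a * \<one>\<^bsub>KQ\<^esub> p) \<otimes>\<^bsub>KQ\<^esub> x) r = a * x r"
      using one_KQ_mult(1)[OF x] by simp
  qed
  ultimately show ?thesis by simp
qed

lemma ideal_linear:
  assumes "ideal I KQ" "x \<in> I" "y \<in> I"
  shows "(\<lambda>p. a * x p + b * y p) \<in> I"
proof -
  have "(\<lambda>p. a * x p) \<oplus>\<^bsub>KQ\<^esub> (\<lambda>p. b * y p) \<in> I"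
    by (intro additive_subgroup.a_closed[OF ideal.axioms(1)] ideal_smult assms)
  then show ?thesis by (simp add: add_KQ)
qed

lemma ideal_diff: "ideal I KQ \<Longrightarrow> x \<in> I \<Longrightarrow> y \<in> I \<Longrightarrow> (\<lambda>p. x p - y p) \<in> I"
  using ideal_linear[of I x y 1 "-1"] by simp

lemma ideal_zero: "ideal I KQ \<Longrightarrow> (\<lambda>p. 0) \<in> I"
  using additive_subgroup.zero_closed[OF ideal.axioms(1)] by (fastforce simp: zero_KQ)

lemma ideal_mult_left: "ideal I KQ \<Longrightarrow> x \<in> I \<Longrightarrow> r \<in> qpaths Q \<Longrightarrow> path_elem r \<otimes>\<^bsub>KQ\<^esub> x \<in> I"
  by (rule ideal.I_l_closed) auto

lemma ideal_mult_right: "ideal I KQ \<Longrightarrow> x \<in> I \<Longrightarrow> r \<in> qpaths Q \<Longrightarrow> x \<otimes>\<^bsub>KQ\<^esub> path_elem r \<in> I"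
  by (rule ideal.I_r_closed) auto

lemma path_elem_mult:
  assumes "p \<in> qpaths Q" "q \<in> qpaths Q" "composable Q p q"
  shows "path_elem p \<otimes>\<^bsub>KQ\<^esub> path_elem q = path_elem (concat_path p q)"
proof
  fix w
  show "(path_elem p \<otimes>\<^bsub>KQ\<^esub> path_elem q) w = path_elem (concat_path p q) w"
  proof (cases "w = concat_path p q")
    case True
    then show ?thesis using path_elem_mult_left[OF assms, of "path_elem q"] by simp
  next
    case False
    then have "(path_elem p \<otimes>\<^bsub>KQ\<^esub> path_elem q) w = 0"
      by (metis path_elem_mult_left_support path_elem_apply)
    then show ?thesis using False by simp
  qed
qed

lemma ideal_of_path_elems:
  assumes "ideal I KQ" "x \<in> carrier KQ" "\<And>p. x p \<noteq> 0 \<Longrightarrow> path_elem p \<in> I"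
  shows "x \<in> I"
proof -
  have "finite A \<Longrightarrow> {p. x p \<noteq> 0} \<subseteq> A \<Longrightarrow> (\<And>p. x p \<noteq> 0 \<Longrightarrow> path_elem p \<in> I) \<Longrightarrow> x \<in> I" for A x
  proof (induction A arbitrary: x rule: finite_induct)
    case empty
    then have "x = (\<lambda>p. 0)" by auto
    then show ?case using ideal_zero[OF assms(1)] by simp
  next
    case (insert a A)
    let ?y = "\<lambda>p. if p = a then 0 else x p"
    have "?y \<in> I"
      by (rule insert.IH) (use insert.prems in \<open>auto split: if_splits\<close>)
    show ?case
    proof (cases "x a = 0")
      case True
      then have "x = ?y" by auto
      then show ?thesis using \<open>?y \<in> I\<close> by simp
    next
      case False
      then have "(\<lambda>p. 1 * ?y p + x a * path_elem a p) \<in> I"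
        using \<open>?y \<in> I\<close> insert.prems by (intro ideal_linear assms(1)) auto
      also have "(\<lambda>p. 1 * ?y p + x a * path_elem a p) = x" by auto
      finally show ?thesis .
    qed
  qed
  from this[of "{p. x p \<noteq> 0}" x] show ?thesis using assms(2,3) by (simp add: carrier_KQ)
qed

text \<open>
  The elements on the right form an ideal, since every path in the support of a product contains a
  path from the support of each factor.  Conversely a path \<open>r s u\<close> with \<open>s \<in> S\<close> is a product with the
  factor \<open>s\<close>, so it lies in the ideal.
\<close>

lemma monomial_ideal_iff:
  assumes S: "S \<subseteq> qpaths Q"
  shows "(x :: _ \<Rightarrow> 'k::field) \<in> monomial_ideal Q S \<longleftrightarrow>
    x \<in> carrier KQ \<and> (\<forall>p. x p \<noteq> 0 \<longrightarrow> (\<exists>s\<in>S. subpath Q s p))"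
proof -
  interpret ring "KQ :: ('k, ('v, 'a) qpath \<Rightarrow> 'k) module" by (rule ring_KQ)
  define M where "M = {x \<in> carrier KQ. \<forall>p. (x p :: 'k) \<noteq> 0 \<longrightarrow> (\<exists>s\<in>S. subpath Q s p)}"
  let ?E = "path_elem ` S :: (_ \<Rightarrow> 'k) set"
  have E: "?E \<subseteq> carrier KQ" using S by auto
  have id: "ideal (monomial_ideal Q S :: (_ \<Rightarrow> 'k) set) KQ"
    unfolding monomial_ideal_def using E by (rule genideal_ideal)
  have "ideal M KQ"
  proof (rule idealI[OF ring_KQ])
    show "subgroup M (add_monoid KQ)"
    proof
      show "M \<subseteq> carrier (add_monoid KQ)" by (auto simp: M_def)
      show "\<one>\<^bsub>add_monoid KQ\<^esub> \<in> M" by (auto simp: M_def zero_KQ carrier_KQ)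
      show "x \<otimes>\<^bsub>add_monoid KQ\<^esub> y \<in> M" if "x \<in> M" "y \<in> M" for x y :: "_ \<Rightarrow> 'k"
      proof -
        have "x p + y p \<noteq> 0 \<Longrightarrow> x p \<noteq> 0 \<or> y p \<noteq> 0" for p by auto
        moreover have "x \<oplus>\<^bsub>KQ\<^esub> y \<in> carrier KQ" using that by (auto simp: M_def)
        ultimately show ?thesis using that by (fastforce simp: M_def add_KQ)
      qed
      show "inv\<^bsub>add_monoid KQ\<^esub> x \<in> M" if "x \<in> M" for x :: "_ \<Rightarrow> 'k"
      proof -
        have "\<ominus>\<^bsub>KQ\<^esub> x \<in> carrier KQ" using that by (auto simp: M_def)
        then have "\<ominus>\<^bsub>KQ\<^esub> x \<in> M" using that by (auto simp: M_def a_inv_KQ)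
        then show ?thesis by (simp add: a_inv_def)
      qed
    qed
  next
    fix x y :: "('v, 'a) qpath \<Rightarrow> 'k" assume x: "x \<in> M" and y: "y \<in> carrier KQ"
    have "\<exists>s\<in>S. subpath Q s w" if "(y \<otimes>\<^bsub>KQ\<^esub> x) w \<noteq> 0" for w
      using that
    proof (rule mult_KQ_support)
      fix p q assume pq: "(p, q) \<in> splits w" and "x q \<noteq> 0"
      then obtain s where "s \<in> S" "subpath Q s q" using x by (auto simp: M_def)
      moreover have "subpath Q q w" using pq by (auto elim!: splitsE intro: subpath_concat_left)
      ultimately show ?thesis using subpath_trans by blast
    qed
    moreover have "\<exists>s\<in>S. subpath Q s w" if "(x \<otimes>\<^bsub>KQ\<^esub> y) w \<noteq> 0" for w
      using that
    proof (rule mult_KQ_support)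
      fix p q assume pq: "(p, q) \<in> splits w" and "x p \<noteq> 0"
      then obtain s where "s \<in> S" "subpath Q s p" using x by (auto simp: M_def)
      moreover have "subpath Q p w" using pq by (auto elim!: splitsE intro: subpath_concat_right)
      ultimately show ?thesis using subpath_trans by blast
    qed
    ultimately show "y \<otimes>\<^bsub>KQ\<^esub> x \<in> M" "x \<otimes>\<^bsub>KQ\<^esub> y \<in> M" using x y by (auto simp: M_def)
  qed
  moreover have "?E \<subseteq> M"
  proof -
    have "\<exists>s\<in>S. subpath Q s p" if "p \<in> S" for p using that S subpath_refl by blast
    then show ?thesis using S by (auto simp: M_def split: if_splits)
  qed
  ultimately have "monomial_ideal Q S \<subseteq> M"
    unfolding monomial_ideal_def by (rule genideal_minimal)
  moreover have "M \<subseteq> monomial_ideal Q S"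
  proof
    fix x assume x: "x \<in> M"
    have "(path_elem p :: _ \<Rightarrow> 'k) \<in> monomial_ideal Q S" if "x p \<noteq> 0" for p
    proof -
      obtain s where s: "s \<in> S" "subpath Q s p" using x \<open>x p \<noteq> 0\<close> by (auto simp: M_def)
      obtain r u where r: "r \<in> qpaths Q" "u \<in> qpaths Q" "composable Q r s"
        "composable Q (concat_path r s) u" "p = concat_path (concat_path r s) u"
        using s(2) unfolding subpath_def by blast
      have "path_elem s \<in> (monomial_ideal Q S :: (_ \<Rightarrow> 'k) set)"
        unfolding monomial_ideal_def using genideal_self[OF E] s(1) by auto
      then have "(path_elem r \<otimes>\<^bsub>KQ\<^esub> path_elem s) \<otimes>\<^bsub>KQ\<^esub> path_elem u
          \<in> (monomial_ideal Q S :: (_ \<Rightarrow> 'k) set)"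
        using id r by (intro ideal_mult_right ideal_mult_left) auto
      moreover have "s \<in> qpaths Q" using s S by auto
      ultimately show ?thesis using r by (simp add: path_elem_mult concat_path_in_qpaths)
    qed
    then show "x \<in> monomial_ideal Q S"
      using x by (simp add: ideal_of_path_elems[OF id] M_def)
  qed
  ultimately show ?thesis by (auto simp: M_def)
qed

lemma monomial_ideal_eq_iff:
  assumes "S \<subseteq> qpaths Q" "S' \<subseteq> qpaths Q"
  shows "(monomial_ideal Q S :: (_ \<Rightarrow> 'k::field) set) = monomial_ideal Q S' \<longleftrightarrow>
    (\<forall>p\<in>qpaths Q. (\<exists>s\<in>S. subpath Q s p) \<longleftrightarrow> (\<exists>s\<in>S'. subpath Q s p))"
    (is "?L \<longleftrightarrow> ?R")
proof
  assume L: ?L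
  show ?R
  proof
    fix p assume p: "p \<in> qpaths Q"
    have "(path_elem p :: _ \<Rightarrow> 'k) \<in> monomial_ideal Q S \<longleftrightarrow> (\<exists>s\<in>S. subpath Q s p)"
      if "S \<subseteq> qpaths Q" for S
      using p by (simp add: monomial_ideal_iff[OF that])
    from this[OF assms(1)] this[OF assms(2)] L
    show "(\<exists>s\<in>S. subpath Q s p) \<longleftrightarrow> (\<exists>s\<in>S'. subpath Q s p)" by simp
  qed
next
  assume ?R
  then show ?L
    unfolding set_eq_iff monomial_ideal_iff[OF assms(1)] monomial_ideal_iff[OF assms(2)]
    by (auto simp: carrier_KQ)
qed

section \<open>Tips of an ideal and the minimal generators\<close>

lemma tips_subset: "ideal I KQ \<Longrightarrow> tips Q R I \<subseteq> qpaths Q"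
  using tip_nonzero(3) ideal_subset unfolding tips_iff subset_iff by metis

text \<open>
  No cancellation can destroy the product of \<open>r\<close> with the tip, and by admissibility it stays on top.
\<close>

lemma tips_concat_left:
  assumes I: "ideal I KQ" and p: "p \<in> tips Q R I" and r: "r \<in> qpaths Q" "composable Q r p"
  shows "concat_path r p \<in> tips Q R I"
proof -
  obtain x where x: "x \<in> I" "x \<noteq> (\<lambda>p. 0)" "tip R x = p" using p by (auto simp: tips_iff)
  have xc: "x \<in> carrier KQ" using I x by (auto dest: ideal_subset)
  have pB: "p \<in> qpaths Q" using tip_nonzero(3)[OF xc x(2)] x(3) by simp
  have y: "(path_elem r \<otimes>\<^bsub>KQ\<^esub> x) (concat_path r p) \<noteq> 0"
    using tip_nonzero(1)[OF xc x(2)] x(3) path_elem_mult_left[OF r(1) pB r(2), of x] by simp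
  have "tip R (path_elem r \<otimes>\<^bsub>KQ\<^esub> x) = concat_path r p"
  proof (rule tip_eqI[where x = "path_elem r \<otimes>\<^bsub>KQ\<^esub> x", OF y])
    fix w assume "(path_elem r \<otimes>\<^bsub>KQ\<^esub> x) w \<noteq> 0"
    then obtain q where q: "q \<in> qpaths Q" "composable Q r q" "w = concat_path r q" "x q \<noteq> 0"
      by (rule path_elem_mult_left_support)
    have "(q, p) \<in> R" using tip_nonzero(2)[OF xc x(2) q(4)] x(3) by simp
    then have "q = p \<or> greater R (concat_path r p) (concat_path r q)"
      using greater_concat_left[OF _ pB q(1) r(1) r(2) q(2)] by (auto simp: greater_def)
    then show "(w, concat_path r p) \<in> R"
      using q pB r by (auto simp: greater_def intro: order_refl concat_path_in_qpaths)
  qed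
  moreover have "path_elem r \<otimes>\<^bsub>KQ\<^esub> x \<noteq> (\<lambda>p. 0)" using y by auto
  ultimately show ?thesis
    using ideal_mult_left[OF I x(1) r(1)] unfolding tips_iff by blast
qed

lemma tips_concat_right:
  assumes I: "ideal I KQ" and p: "p \<in> tips Q R I" and s: "s \<in> qpaths Q" "composable Q p s"
  shows "concat_path p s \<in> tips Q R I"
proof -
  obtain x where x: "x \<in> I" "x \<noteq> (\<lambda>p. 0)" "tip R x = p" using p by (auto simp: tips_iff)
  have xc: "x \<in> carrier KQ" using I x by (auto dest: ideal_subset)
  have pB: "p \<in> qpaths Q" using tip_nonzero(3)[OF xc x(2)] x(3) by simp
  have y: "(x \<otimes>\<^bsub>KQ\<^esub> path_elem s) (concat_path p s) \<noteq> 0"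
    using tip_nonzero(1)[OF xc x(2)] x(3) path_elem_mult_right[OF s(1) pB s(2), of x] by simp
  have "tip R (x \<otimes>\<^bsub>KQ\<^esub> path_elem s) = concat_path p s"
  proof (rule tip_eqI[where x = "x \<otimes>\<^bsub>KQ\<^esub> path_elem s", OF y])
    fix w assume "(x \<otimes>\<^bsub>KQ\<^esub> path_elem s) w \<noteq> 0"
    then obtain q where q: "q \<in> qpaths Q" "composable Q q s" "w = concat_path q s" "x q \<noteq> 0"
      by (rule path_elem_mult_right_support)
    have "(q, p) \<in> R" using tip_nonzero(2)[OF xc x(2) q(4)] x(3) by simp
    then have "q = p \<or> greater R (concat_path p s) (concat_path q s)"
      using greater_concat_right[OF _ pB q(1) s(1) s(2) q(2)] by (auto simp: greater_def)
    then show "(w, concat_path p s) \<in> R"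
      using q pB s by (auto simp: greater_def intro: order_refl concat_path_in_qpaths)
  qed
  moreover have "x \<otimes>\<^bsub>KQ\<^esub> path_elem s \<noteq> (\<lambda>p. 0)" using y by auto
  ultimately show ?thesis
    using ideal_mult_right[OF I x(1) s(1)] unfolding tips_iff by blast
qed

lemma tips_upward_closed:
  assumes "ideal I KQ" "p \<in> tips Q R I" "subpath Q p q"
  shows "q \<in> tips Q R I"
  using assms(3) tips_concat_left[OF assms(1,2)] tips_concat_right[OF assms(1)]
  unfolding subpath_def by blast

definition minimal_paths :: "('v, 'a) qpath set \<Rightarrow> ('v, 'a) qpath set" where
  "minimal_paths U = {p \<in> U. \<forall>q\<in>U. subpath Q q p \<longrightarrow> q = p}"

text \<open>
  A proper subpath is strictly shorter, so descending in the subpath order terminates.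
\<close>

lemma minimal_path_below:
  assumes "p \<in> U" "U \<subseteq> qpaths Q"
  shows "\<exists>s\<in>minimal_paths U. subpath Q s p"
  using assms(1)
proof (induction "qlength p" arbitrary: p rule: less_induct)
  case less
  show ?case
  proof (cases "p \<in> minimal_paths U")
    case True
    then show ?thesis using less.prems assms(2) subpath_refl by blast
  next
    case False
    then obtain q where q: "q \<in> U" "subpath Q q p" "q \<noteq> p"
      using less.prems by (auto simp: minimal_paths_def)
    then have "qlength q < qlength p" using subpath_eq_of_length not_less by blast
    then show ?thesis using less.hyps q subpath_trans by blast
  qed
qed

lemma antichain_eq_minimal_paths:
  assumes "S \<subseteq> qpaths Q" "\<And>s s'. s \<in> S \<Longrightarrow> s' \<in> S \<Longrightarrow> subpath Q s s' \<Longrightarrow> s = s'"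
    and "\<And>p. p \<in> U \<longleftrightarrow> p \<in> qpaths Q \<and> (\<exists>s\<in>S. subpath Q s p)"
  shows "S = minimal_paths U"
proof
  show "S \<subseteq> minimal_paths U"
  proof
    fix s assume s: "s \<in> S"
    then have "s \<in> U" using assms(1,3) subpath_refl by blast
    moreover have "q = s" if q: "q \<in> U" "subpath Q q s" for q
    proof -
      obtain s' where "s' \<in> S" "subpath Q s' q" using q assms(3) by blast
      then have "s' = s" using assms(2) s q subpath_trans by blast
      then show ?thesis using \<open>subpath Q s' q\<close> q subpath_antisym by blast
    qed
    ultimately show "s \<in> minimal_paths U" by (auto simp: minimal_paths_def)
  qed
  show "minimal_paths U \<subseteq> S"
    using assms(1,3) subpath_refl unfolding minimal_paths_def by blast
qed

text \<open>
  A generator with another one below it is redundant, so a minimal generating set is an antichain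
  whose upward closure is \<open>U\<close>, which leaves only the minimal elements of \<open>U\<close>.  These do generate,
  and none can be dropped, since nothing else in \<open>U\<close> lies below it.
\<close>

lemma minimal_generators_unique:
  fixes U :: "('v, 'a) qpath set"
  assumes U: "U \<subseteq> qpaths Q" and closed: "\<And>p q. p \<in> U \<Longrightarrow> subpath Q p q \<Longrightarrow> q \<in> U"
  shows "S \<subseteq> qpaths Q \<and> (monomial_ideal Q S :: (_ \<Rightarrow> 'k::field) set) = monomial_ideal Q U \<and>
      (\<forall>S'. S' \<subset> S \<longrightarrow> (monomial_ideal Q S' :: (_ \<Rightarrow> 'k) set) \<noteq> monomial_ideal Q U) \<longleftrightarrow>
    S = minimal_paths U"
    (is "?L \<longleftrightarrow> _")
proof
  have up: "p \<in> U \<longleftrightarrow> p \<in> qpaths Q \<and> (\<exists>s\<in>U. subpath Q s p)" for p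
    using U closed subpath_refl by blast
  show "S = minimal_paths U" if L: ?L
  proof -
    from L have gen: "p \<in> U \<longleftrightarrow> p \<in> qpaths Q \<and> (\<exists>s\<in>S. subpath Q s p)" for p
      using up[of p] monomial_ideal_eq_iff[OF _ U, of S] by blast
    show ?thesis
    proof (rule antichain_eq_minimal_paths)
      show "S \<subseteq> qpaths Q" using L by simp
      fix s s' assume s: "s \<in> S" "s' \<in> S" "subpath Q s s'"
      show "s = s'"
      proof (rule ccontr)
        assume ne: "s \<noteq> s'"
        have "(\<exists>u\<in>S - {s'}. subpath Q u p) \<longleftrightarrow> (\<exists>u\<in>S. subpath Q u p)" for p
          using s ne subpath_trans by blast
        then have "(monomial_ideal Q (S - {s'}) :: (_ \<Rightarrow> 'k) set) = monomial_ideal Q S"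
          using L by (subst monomial_ideal_eq_iff) auto
        moreover have "S - {s'} \<subset> S" using s by auto
        ultimately show False using L by metis
      qed
    qed (rule gen)
  qed
  assume S: "S = minimal_paths U"
  have SU: "S \<subseteq> U" by (auto simp: S minimal_paths_def)
  have eq: "(monomial_ideal Q S :: (_ \<Rightarrow> 'k) set) = monomial_ideal Q U"
    using U SU minimal_path_below[OF _ U] closed unfolding S[symmetric]
    by (subst monomial_ideal_eq_iff) (blast intro: subpath_trans)+
  have "(monomial_ideal Q S' :: (_ \<Rightarrow> 'k) set) \<noteq> monomial_ideal Q U" if sub: "S' \<subset> S" for S'
  proof
    assume a: "(monomial_ideal Q S' :: (_ \<Rightarrow> 'k) set) = monomial_ideal Q U"
    obtain s where s: "s \<in> S" "s \<notin> S'" using sub by blast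
    have "s \<in> U" "s \<in> qpaths Q" using s SU U by auto
    then obtain s' where s': "s' \<in> S'" "subpath Q s' s"
      using a monomial_ideal_eq_iff[of S' U] sub SU U up[of s] by blast
    then have "s' = s" using s sub SU unfolding S minimal_paths_def by blast
    then show False using s s' by simp
  qed
  then show ?L using eq SU U by auto
qed

lemma minimal_generators_of_I_Mon:
  fixes I :: "(('v, 'a) qpath \<Rightarrow> 'k::field) set"
  assumes "ideal I KQ"
  shows "S \<subseteq> qpaths Q \<and> monomial_ideal Q S = I_Mon Q R I \<and>
      (\<forall>S'. S' \<subset> S \<longrightarrow> monomial_ideal Q S' \<noteq> I_Mon Q R I) \<longleftrightarrow>
    S = minimal_paths (tips Q R I)"
  unfolding I_Mon_def
  by (rule minimal_generators_unique[OF tips_subset[OF assms]])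
    (rule tips_upward_closed[OF assms])

lemma min_tips_eq:
  fixes I :: "(('v, 'a) qpath \<Rightarrow> 'k::field) set"
  assumes "ideal I KQ"
  shows "min_tips Q R I = minimal_paths (tips Q R I)"
  unfolding min_tips_def minimal_generators_of_I_Mon[OF assms] by simp

text \<open>
  Both \<open>tips Q R I\<close> and \<open>T\<close> generate the same monomial ideal, so they have the same upward closure,
  and \<open>tips Q R I\<close> is its own.
\<close>

lemma tips_of_I_Mon:
  fixes I :: "(('v, 'a) qpath \<Rightarrow> 'k::field) set"
  assumes I: "ideal I KQ" and T: "T \<subseteq> qpaths Q" and mon: "I_Mon Q R I = monomial_ideal Q T"
  shows "p \<in> tips Q R I \<longleftrightarrow> p \<in> qpaths Q \<and> (\<exists>t\<in>T. subpath Q t p)"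
proof -
  have "p \<in> tips Q R I \<longleftrightarrow> (\<exists>t\<in>T. subpath Q t p)" if p: "p \<in> qpaths Q"
  proof -
    have "p \<in> tips Q R I \<longleftrightarrow> (\<exists>s\<in>tips Q R I. subpath Q s p)"
      using tips_upward_closed[OF I] subpath_refl[OF p] by blast
    also have "\<dots> \<longleftrightarrow> (\<exists>t\<in>T. subpath Q t p)"
      using monomial_ideal_eq_iff[OF tips_subset[OF I] T, where 'k = 'k] mon p
      unfolding I_Mon_def by simp
    finally show ?thesis .
  qed
  then show ?thesis using tips_subset[OF I] by blast
qed

lemma normal_paths_of_I_Mon:
  fixes I :: "(('v, 'a) qpath \<Rightarrow> 'k::field) set"
  assumes "ideal I KQ" "T \<subseteq> qpaths Q" "I_Mon Q R I = monomial_ideal Q T"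
  shows "qpaths Q - tips Q R I = normal_paths Q T"
  using tips_of_I_Mon[OF assms] by (auto simp: normal_paths_def)

lemma min_tips_of_I_Mon:
  fixes I :: "(('v, 'a) qpath \<Rightarrow> 'k::field) set"
  assumes "ideal I KQ" "T \<subseteq> qpaths Q" "I_Mon Q R I = monomial_ideal Q T"
    and "\<And>s t. s \<in> T \<Longrightarrow> t \<in> T \<Longrightarrow> subpath Q s t \<Longrightarrow> s = t"
  shows "min_tips Q R I = T"
  unfolding min_tips_eq[OF assms(1)]
  using antichain_eq_minimal_paths[OF assms(2,4) tips_of_I_Mon[OF assms(1-3)]] by simp

lemma I_Mon_min_tips:
  fixes I :: "(('v, 'a) qpath \<Rightarrow> 'k::field) set"
  assumes "ideal I KQ"
  shows "I_Mon Q R I = monomial_ideal Q (min_tips Q R I)"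
  using minimal_generators_of_I_Mon[OF assms] min_tips_eq[OF assms] by blast

section \<open>Normal forms and the reduced Groebner basis\<close>

lemma ideal_Int_nontips:
  assumes "ideal I KQ" "x \<in> I" "x \<in> path_span Q (qpaths Q - tips Q R I)"
  shows "x = (\<lambda>p. 0)"
proof (rule ccontr)
  assume nz: "x \<noteq> (\<lambda>p. 0)"
  have "x (tip R x) \<noteq> 0" using tip_nonzero(1)[OF ideal_subset[OF assms(1,2)] nz] .
  moreover have "tip R x \<in> tips Q R I" using assms(2) nz by (auto simp: tips_iff)
  ultimately show False using assms(3) by (auto simp: path_span_def)
qed

text \<open>
  The division algorithm.  If the tip of \<open>x\<close> is a tip of \<open>I\<close>, a multiple of an element of \<open>I\<close> cancels
  it; otherwise the tip belongs to the remainder and is set aside.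
\<close>

lemma normal_form_exists:
  assumes I: "ideal I KQ" and "x \<in> carrier KQ"
  shows "\<exists>g\<in>I. \<forall>p. x p - g p \<noteq> 0 \<longrightarrow> p \<in> qpaths Q - tips Q R I"
  using assms(2)
proof (induction x rule: tip_induct)
  case zero
  show ?case using ideal_zero[OF I] by (intro bexI[of _ "\<lambda>p. 0"]) auto
next
  case (reduce x)
  let ?t = "tip R x"
  show ?case
  proof (cases "?t \<in> tips Q R I")
    case True
    then obtain y where y: "y \<in> I" "y \<noteq> (\<lambda>p. 0)" "tip R y = ?t" by (auto simp: tips_iff)
    have yc: "y \<in> carrier KQ" using I y by (auto dest: ideal_subset)
    let ?a = "x ?t / y ?t"
    have "(\<lambda>p. x p - ?a * y p) \<in> carrier KQ"
      using carrier_KQ_linear[OF reduce.hyps(1) yc, of 1 "- ?a"] by simp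
    then obtain g where g: "g \<in> I" "\<forall>p. x p - ?a * y p - g p \<noteq> 0 \<longrightarrow> p \<in> qpaths Q - tips Q R I"
      using reduce.IH cancel_tip[OF reduce.hyps yc y(2,3)] by blast
    have "(\<lambda>p. ?a * y p + 1 * g p) \<in> I" using I y(1) g(1) by (rule ideal_linear)
    then show ?thesis
      using g(2) by (intro bexI[of _ "\<lambda>p. ?a * y p + 1 * g p"]) (auto simp: algebra_simps)
  next
    case False
    have tB: "?t \<in> qpaths Q" using reduce.hyps by (rule tip_nonzero(3))
    let ?x = "\<lambda>p. x p - x ?t * path_elem ?t p"
    have "?x \<in> carrier KQ"
      using carrier_KQ_linear[OF reduce.hyps(1), of "path_elem ?t" 1 "- x ?t"] tB by simp
    moreover have "greater R ?t q" if "?x q \<noteq> 0" for q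
      using that tip_nonzero(2)[OF reduce.hyps] by (auto simp: greater_def split: if_splits)
    ultimately obtain g where g: "g \<in> I" "\<forall>p. ?x p - g p \<noteq> 0 \<longrightarrow> p \<in> qpaths Q - tips Q R I"
      using reduce.IH by blast
    have "p \<in> qpaths Q - tips Q R I" if "x p - g p \<noteq> 0" for p
      using that g(2)[rule_format, of p] False tB by (cases "p = ?t") simp_all
    then show ?thesis using g(1) by blast
  qed
qed

text \<open>
  Dividing \<open>x \<in> I\<close> by \<open>J\<close> leaves a remainder in \<open>I\<close> that involves no tip of \<open>I\<close>, which is 0.
\<close>

lemma ideal_eq_of_tips:
  assumes "ideal I KQ" "ideal J KQ" "J \<subseteq> I" "tips Q R I \<subseteq> tips Q R J"
  shows "J = I"
proof
  show "I \<subseteq> J"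
  proof
    fix x assume x: "x \<in> I"
    then obtain g where g: "g \<in> J" "\<forall>p. x p - g p \<noteq> 0 \<longrightarrow> p \<in> qpaths Q - tips Q R J"
      using normal_form_exists[OF assms(2)] assms(1) ideal_subset by blast
    have d: "(\<lambda>p. x p - g p) \<in> I" using x g assms by (intro ideal_diff) auto
    moreover have "(\<lambda>p. x p - g p) \<in> path_span Q (qpaths Q - tips Q R I)"
      using ideal_subset[OF assms(1) d] g(2) assms(4) by (auto simp: path_span_def)
    ultimately have "(\<lambda>p. x p - g p) = (\<lambda>p. 0)" using ideal_Int_nontips assms(1) by blast
    then have "x = g" by (auto simp: fun_eq_iff)
    then show "x \<in> J" using g by simp
  qed
qed (rule assms(3))

lemma reduced_elem_eqI:
  assumes I: "ideal I KQ" and t: "t \<in> qpaths Q" and g: "g \<in> I"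
    and span: "\<And>p. path_elem t p - g p \<noteq> 0 \<Longrightarrow> p \<in> qpaths Q - tips Q R I"
  shows "reduced_elem Q R I t = g"
proof -
  have iff: "path_elem t \<ominus>\<^bsub>KQ\<^esub> h \<in> path_span Q (qpaths Q - tips Q R I) \<longleftrightarrow>
      (\<forall>p. path_elem t p - h p \<noteq> 0 \<longrightarrow> p \<in> qpaths Q - tips Q R I)" if "h \<in> I" for h
  proof -
    have h: "h \<in> carrier KQ" using I that by (rule ideal_subset)
    have "(\<lambda>p. path_elem t p - h p) \<in> carrier KQ"
      using carrier_KQ_linear[OF _ h, of "path_elem t" 1 "-1"] t by simp
    then show ?thesis using h by (auto simp: minus_KQ path_span_def)
  qed
  show ?thesis
    unfolding reduced_elem_def
  proof (rule the_equality)
    show "g \<in> I \<and> path_elem t \<ominus>\<^bsub>KQ\<^esub> g \<in> path_span Q (qpaths Q - tips Q R I)"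
      using iff[OF g] g span by blast
    fix h assume "h \<in> I \<and> path_elem t \<ominus>\<^bsub>KQ\<^esub> h \<in> path_span Q (qpaths Q - tips Q R I)"
    then have h: "h \<in> I" "\<And>p. path_elem t p - h p \<noteq> 0 \<Longrightarrow> p \<in> qpaths Q - tips Q R I"
      using iff by blast+
    have d: "(\<lambda>p. h p - g p) \<in> I" using I h(1) g by (rule ideal_diff)
    have "p \<in> qpaths Q - tips Q R I" if "h p - g p \<noteq> 0" for p
    proof -
      have "path_elem t p - h p \<noteq> 0 \<or> path_elem t p - g p \<noteq> 0" using that by auto
      then show ?thesis using h(2) span by blast
    qed
    then have "(\<lambda>p. h p - g p) \<in> path_span Q (qpaths Q - tips Q R I)"
      using ideal_subset[OF I d] by (auto simp: path_span_def)
    then have "(\<lambda>p. h p - g p) = (\<lambda>p. 0)" using ideal_Int_nontips[OF I d] by blast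
    then show "h = g" by (auto simp: fun_eq_iff)
  qed
qed

lemma reduced_elem_props:
  assumes I: "ideal I KQ" and t: "t \<in> qpaths Q"
  shows "reduced_elem Q R I t \<in> I"
    and "path_elem t p - reduced_elem Q R I t p \<noteq> 0 \<Longrightarrow> p \<in> qpaths Q - tips Q R I"
proof -
  obtain g where g: "g \<in> I" "\<And>p. path_elem t p - g p \<noteq> 0 \<Longrightarrow> p \<in> qpaths Q - tips Q R I"
    using normal_form_exists[OF I, of "path_elem t"] t by auto
  have "reduced_elem Q R I t = g" using I t g by (rule reduced_elem_eqI)
  then show "reduced_elem Q R I t \<in> I"
    and "path_elem t p - reduced_elem Q R I t p \<noteq> 0 \<Longrightarrow> p \<in> qpaths Q - tips Q R I"
    using g by auto
qed

text \<open>
  The path \<open>t\<close> is a tip and so cannot occur in the remainder \<open>t - g\<close>; no other tip of \<open>I\<close> occurs in \<open>g\<close>,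
  because it would occur in \<open>t - g\<close> as well.
\<close>

lemma reduced_elem_tip:
  fixes I :: "(('v, 'a) qpath \<Rightarrow> 'k::field) set"
  assumes I: "ideal I KQ" and t: "t \<in> tips Q R I"
  shows "tip R (reduced_elem Q R I t) = t"
    and "reduced_elem Q R I t t = 1"
    and "reduced_elem Q R I t \<noteq> (\<lambda>p. 0)"
proof -
  let ?g = "reduced_elem Q R I t"
  have tB: "t \<in> qpaths Q" using I t tips_subset by blast
  note g = reduced_elem_props[OF I tB]
  show one: "?g t = 1" using g(2)[of t] t by auto
  then show nz: "?g \<noteq> (\<lambda>p. 0)" by (auto dest: fun_cong[of _ _ t])
  have "tip R ?g \<in> tips Q R I" using g(1) nz by (auto simp: tips_iff)
  moreover have "?g (tip R ?g) \<noteq> 0" using tip_nonzero(1)[OF ideal_subset[OF I g(1)] nz] .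
  ultimately show "tip R ?g = t" using g(2)[of "tip R ?g"] by (cases "tip R ?g = t") simp_all
qed

text \<open>
  Cutting the reduced element down to the paths parallel to \<open>t\<close>, by multiplying with the trivial
  paths at both ends of \<open>t\<close>, yields another reduced element, so by uniqueness changes nothing.
\<close>

lemma reduced_elem_parallel:
  fixes I :: "(('v, 'a) qpath \<Rightarrow> 'k::field) set"
  assumes I: "ideal I KQ" and t: "t \<in> qpaths Q" and nz: "reduced_elem Q R I t p \<noteq> 0"
  shows "parallel Q p t"
proof -
  let ?g = "reduced_elem Q R I t"
  let ?u = "(origin t, [])" and ?v = "(terminus Q t, [])"
  let ?h = "(path_elem ?u \<otimes>\<^bsub>KQ\<^esub> ?g) \<otimes>\<^bsub>KQ\<^esub> path_elem ?v"
  have uv: "?u \<in> qpaths Q" "?v \<in> qpaths Q" using t by (auto simp: origin_in_verts terminus_in_verts)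
  note g = reduced_elem_props[OF I t]
  have hI: "?h \<in> I" using I g(1) uv by (intro ideal_mult_left ideal_mult_right)
  have on: "?h w = ?g w" if "w \<in> qpaths Q" "parallel Q w t" for w
  proof -
    have "?h (concat_path w ?v) = (path_elem ?u \<otimes>\<^bsub>KQ\<^esub> ?g) w"
      using uv that by (intro path_elem_mult_right) (auto simp: parallel_def composable_def)
    moreover have "(path_elem ?u \<otimes>\<^bsub>KQ\<^esub> ?g) (concat_path ?u w) = ?g w"
      using uv that by (intro path_elem_mult_left) (auto simp: parallel_def composable_def)
    ultimately show ?thesis
      using that by (simp add: concat_trivial_left parallel_def composable_def)
  qed
  have off: "?h w = 0" if "\<not> (w \<in> qpaths Q \<and> parallel Q w t)" for w
  proof (rule ccontr)
    assume "?h w \<noteq> 0"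
    then obtain w' where w': "w' \<in> qpaths Q" "composable Q w' ?v" "w = concat_path w' ?v"
        "(path_elem ?u \<otimes>\<^bsub>KQ\<^esub> ?g) w' \<noteq> 0"
      by (rule path_elem_mult_right_support)
    from w'(4) obtain w'' where "w'' \<in> qpaths Q" "composable Q ?u w''" "w' = concat_path ?u w''"
      by (rule path_elem_mult_left_support)
    then show False using w' that by (simp add: parallel_def composable_def)
  qed
  have "?g = ?h"
  proof (rule reduced_elem_eqI[OF I t hI])
    fix w assume w: "path_elem t w - ?h w \<noteq> 0"
    then have "w \<in> qpaths Q \<and> parallel Q w t"
      using off[of w] t by (auto simp: parallel_def split: if_splits)
    then show "w \<in> qpaths Q - tips Q R I" using w on g(2) by auto
  qed
  then show ?thesis using nz off by metis
qed

section \<open>The correspondence\<close>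

lemma array_elem_apply:
  assumes c: "c \<in> arrays Q R T" and t: "t \<in> T"
  shows "path_elem t \<ominus>\<^bsub>KQ\<^esub> (\<lambda>n. if n \<in> normal_below Q R T t then c t n else 0) =
    (\<lambda>p. path_elem t p - c t p)"
    and "(\<lambda>p. c t p) \<in> carrier KQ"
proof -
  have eq: "(\<lambda>n. if n \<in> normal_below Q R T t then c t n else 0) = (\<lambda>p. c t p)"
    using c unfolding arrays_def by force
  show "(\<lambda>p. c t p) \<in> carrier KQ"
    using c t by (auto simp: arrays_def carrier_KQ normal_below_def normal_paths_def)
  then show "path_elem t \<ominus>\<^bsub>KQ\<^esub> (\<lambda>n. if n \<in> normal_below Q R T t then c t n else 0) =
    (\<lambda>p. path_elem t p - c t p)"
    unfolding eq by (rule minus_KQ)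
qed

lemma array_elems_eq:
  assumes "c \<in> arrays Q R T"
  shows "array_elems Q R T c = (\<lambda>t p. path_elem t p - c t p) ` T"
  using array_elem_apply(1)[OF assms] unfolding array_elems_def by force

lemma array_diag_zero:
  assumes "c \<in> arrays Q R T"
  shows "c t t = 0"
  using assms unfolding arrays_def normal_below_def greater_def by blast

lemma array_elem_tip:
  assumes c: "c \<in> arrays Q R T" and t: "t \<in> T" "T \<subseteq> qpaths Q"
  shows "tip R (\<lambda>p. path_elem t p - c t p) = t"
proof (rule tip_eqI)
  show "path_elem t t - c t t \<noteq> 0" using array_diag_zero[OF c] by simp
  fix q assume "path_elem t q - c t q \<noteq> 0"
  then have "q = t \<or> c t q \<noteq> 0" by (auto split: if_splits)
  then show "(q, t) \<in> R"
    using c t order_refl unfolding arrays_def normal_below_def greater_def by blast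
qed

lemma array_ideal_ideal:
  assumes "c \<in> arrays Q R T" "T \<subseteq> qpaths Q"
  shows "array_elems Q R T c \<subseteq> carrier KQ" "ideal (array_ideal Q R T c) KQ"
proof -
  show "array_elems Q R T c \<subseteq> carrier KQ"
  proof -
    have "(\<lambda>p. path_elem t p - c t p) \<in> carrier KQ" if "t \<in> T" for t
      using carrier_KQ_linear[OF _ array_elem_apply(2)[OF assms(1) that], of "path_elem t" 1 "-1"]
        that assms(2) by auto
    then show ?thesis unfolding array_elems_eq[OF assms(1)] by auto
  qed
  then show "ideal (array_ideal Q R T c) KQ"
    unfolding array_ideal_def by (rule ring.genideal_ideal[OF ring_KQ])
qed

text \<open>
  Take tips on both sides of the defining equation of \<open>V\<close>: the array element at \<open>t\<close> has tip \<open>t\<close>, and so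
  has the reduced element at a tip \<open>t\<close>.
\<close>

lemma V_min_tips:
  assumes c: "c \<in> V Q R T" and T: "T \<subseteq> qpaths Q"
  shows "min_tips Q R (array_ideal Q R T c) = T"
proof -
  have ca: "c \<in> arrays Q R T" using c by (simp add: V_def)
  let ?I = "array_ideal Q R T c"
  have I: "ideal ?I KQ" using ca T by (rule array_ideal_ideal)
  have "T = tip R ` array_elems Q R T c"
    unfolding array_elems_eq[OF ca] using array_elem_tip[OF ca _ T] by force
  also have "\<dots> = tip R ` reduced_elem Q R ?I ` min_tips Q R ?I"
    using c by (simp add: V_def reduced_groebner_basis_def)
  also have "\<dots> = min_tips Q R ?I"
    using reduced_elem_tip(1)[OF I] unfolding min_tips_eq[OF I] minimal_paths_def image_image
    by force
  finally show ?thesis by simp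
qed

lemma V_array_unique:
  assumes c: "c \<in> V Q R T" and d: "d \<in> V Q R T" and T: "T \<subseteq> qpaths Q"
    and eq: "array_ideal Q R T c = array_ideal Q R T d"
  shows "c = d"
proof -
  have ca: "c \<in> arrays Q R T" "d \<in> arrays Q R T" using c d by (simp_all add: V_def)
  have elems: "array_elems Q R T c = array_elems Q R T d" using c d eq by (simp add: V_def)
  have "c t n = d t n" for t n
  proof (cases "t \<in> T")
    case True
    then have "(\<lambda>p. path_elem t p - c t p) \<in> array_elems Q R T d"
      unfolding elems[symmetric] array_elems_eq[OF ca(1)] by blast
    then obtain s where s: "s \<in> T" "(\<lambda>p. path_elem t p - c t p) = (\<lambda>p. path_elem s p - d s p)"
      unfolding array_elems_eq[OF ca(2)] by blast
    have "s = t" using array_elem_tip[OF ca(1) True T] array_elem_tip[OF ca(2) s(1) T] s(2) by simp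
    then show ?thesis using fun_cong[OF s(2), of n] by simp
  next
    case False
    then have "c t n = 0" "d t n = 0" using ca unfolding arrays_def by blast+
    then show ?thesis by simp
  qed
  then show ?thesis by blast
qed

text \<open>
  The array consists of the coefficients of the remainders \<open>t - g\<^sub>t\<close>.  The elements \<open>g\<^sub>t\<close> generate \<open>I\<close>
  because every tip of \<open>I\<close> has a subpath \<open>t \<in> T\<close>, hence is a tip of the ideal they generate.
\<close>

lemma V_array_exists:
  fixes I :: "(('v, 'a) qpath \<Rightarrow> 'k::field) set"
  assumes I: "ideal I KQ" and T: "T \<subseteq> qpaths Q" and mon: "I_Mon Q R I = monomial_ideal Q T"
    and antichain: "\<And>s t. s \<in> T \<Longrightarrow> t \<in> T \<Longrightarrow> subpath Q s t \<Longrightarrow> s = t"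
  shows "\<exists>c\<in>V Q R T. array_ideal Q R T c = I"
proof -
  define c where "c = (\<lambda>t n. if t \<in> T then path_elem t n - reduced_elem Q R I t n else 0)"
  have tips: "T \<subseteq> tips Q R I" using tips_of_I_Mon[OF I T mon] T subpath_refl by blast
  have below: "n \<in> normal_below Q R T t" if "t \<in> T" "c t n \<noteq> 0" for t n
  proof -
    have t: "t \<in> tips Q R I" "t \<in> qpaths Q" using that tips T by auto
    have nz: "path_elem t n - reduced_elem Q R I t n \<noteq> 0" using that by (simp add: c_def)
    then have n: "n \<in> normal_paths Q T"
      using reduced_elem_props(2)[OF I t(2)] normal_paths_of_I_Mon[OF I T mon] by blast
    have "n \<noteq> t" using nz reduced_elem_tip(2)[OF I t(1)] by auto
    then have g: "reduced_elem Q R I t n \<noteq> 0" using nz by auto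
    have "(n, t) \<in> R"
      using tip_nonzero(2)[OF ideal_subset[OF I reduced_elem_props(1)[OF I t(2)]]
          reduced_elem_tip(3)[OF I t(1)] g] reduced_elem_tip(1)[OF I t(1)] by simp
    then show ?thesis
      using n \<open>n \<noteq> t\<close> reduced_elem_parallel[OF I t(2) g] by (auto simp: normal_below_def greater_def)
  qed
  have fin: "finite {n. c t n \<noteq> 0}" if "t \<in> T" for t
  proof -
    have t: "t \<in> qpaths Q" using that T by auto
    have "(\<lambda>p. path_elem t p - reduced_elem Q R I t p) \<in> carrier KQ"
      using carrier_KQ_linear[OF _ ideal_subset[OF I reduced_elem_props(1)[OF I t]],
          of "path_elem t" 1 "-1"] t by simp
    then show ?thesis using that by (simp add: c_def carrier_KQ)
  qed
  have ca: "c \<in> arrays Q R T"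
    using below fin unfolding arrays_def by (auto simp: c_def split: if_splits)
  have elems: "array_elems Q R T c = reduced_elem Q R I ` T"
    unfolding array_elems_eq[OF ca] by (rule image_cong) (auto simp: c_def)
  let ?J = "array_ideal Q R T c"
  have J: "ideal ?J KQ" "array_elems Q R T c \<subseteq> ?J"
    using array_ideal_ideal[OF ca T] ring.genideal_self[OF ring_KQ]
    unfolding array_ideal_def by blast+
  have "?J \<subseteq> I"
    unfolding array_ideal_def elems
    using I T reduced_elem_props(1)[OF I] by (intro ring.genideal_minimal[OF ring_KQ]) auto
  moreover have "tips Q R I \<subseteq> tips Q R ?J"
  proof
    fix p assume "p \<in> tips Q R I"
    then obtain t where t: "t \<in> T" "subpath Q t p" using tips_of_I_Mon[OF I T mon] by blast
    then have tI: "t \<in> tips Q R I" using tips by auto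
    have "reduced_elem Q R I t \<in> ?J" using J(2) t(1) unfolding elems by auto
    then have "t \<in> tips Q R ?J" using reduced_elem_tip[OF I tI] by (auto simp: tips_iff)
    then show "p \<in> tips Q R ?J" using J(1) t(2) tips_upward_closed by blast
  qed
  ultimately have JI: "?J = I" using I J(1) by (intro ideal_eq_of_tips)
  have "min_tips Q R I = T" using I T mon antichain by (rule min_tips_of_I_Mon)
  then have "c \<in> V Q R T" using ca elems JI by (simp add: V_def reduced_groebner_basis_def)
  then show ?thesis using JI by blast
qed

end

text \<open>
  The zero of the quotient by \<open>I\<close> is the coset \<open>I\<close> itself.
\<close>

lemma quotient_algebra_inject:
  assumes "quotient_algebra A I = quotient_algebra A J"
  shows "I = J"
  using arg_cong[OF assms, of "\<lambda>B. \<zero>\<^bsub>B\<^esub>"] by (simp add: quotient_algebra_def FactRing_def)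

theorem theorem4p3:
  fixes Q :: "('v, 'a) pre_digraph"
    and R :: "('v, 'a) qpath rel"
    and T :: "('v, 'a) qpath set"
  assumes "fin_digraph Q"
    and "admissible_order Q R"
    and "T \<subseteq> qpaths Q"
    and "tip_reduced Q R (path_elem ` T :: (('v, 'a) qpath \<Rightarrow> 'k::field) set)"
    and "\<And>t. t \<in> T \<Longrightarrow> qlength t \<ge> 2"
  shows "bij_betw (\<lambda>c. quotient_algebra (path_algebra Q) (array_ideal Q R T c))
           (V Q R T)
           (Alg Q R T :: ('k, (('v, 'a) qpath \<Rightarrow> 'k) set) module set)"
proof -
  interpret ordered_quiver Q R
    using assms(1,2) by (intro ordered_quiver.intro ordered_quiver_axioms.intro)
  \<comment> \<open>Distinct paths are distinct nonzero elements of the algebra, each its own tip, so tip-reducedness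
    is a statement about the paths themselves.\<close>
  have antichain: "s = t" if "s \<in> T" "t \<in> T" "subpath Q s t" for s t
  proof (rule ccontr)
    assume "s \<noteq> t"
    have nz: "path_elem p \<in> path_elem ` T - {\<zero>\<^bsub>KQ\<^esub> :: _ \<Rightarrow> 'k}" if "p \<in> T" for p
    proof -
      have "path_elem p p \<noteq> \<zero>\<^bsub>KQ\<^esub> p" by (simp add: zero_KQ)
      then show ?thesis using that by (metis DiffI imageI singletonD)
    qed
    have "path_elem s s \<noteq> (path_elem t s :: 'k)" using \<open>s \<noteq> t\<close> by simp
    then have "(path_elem s :: _ \<Rightarrow> 'k) \<noteq> path_elem t" by metis
    then have "\<not> subpath Q (tip R (path_elem s :: _ \<Rightarrow> 'k)) (tip R (path_elem t :: _ \<Rightarrow> 'k))"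
      using assms(4) nz[OF that(1)] nz[OF that(2)] unfolding tip_reduced_def by (elim ballE) auto
    moreover have "tip R (path_elem p :: _ \<Rightarrow> 'k) = p" if "p \<in> T" for p
      by (rule tip_path_elem) (use assms(3) that in blast)
    ultimately show False using that by simp
  qed
  show ?thesis
  proof (rule bij_betw_imageI)
    show "inj_on (\<lambda>c. quotient_algebra KQ (array_ideal Q R T c :: (_ \<Rightarrow> 'k) set)) (V Q R T)"
      by (intro inj_onI) (rule V_array_unique[OF _ _ assms(3) quotient_algebra_inject])
    show "(\<lambda>c. quotient_algebra KQ (array_ideal Q R T c)) ` V Q R T =
        (Alg Q R T :: ('k, (('v, 'a) qpath \<Rightarrow> 'k) set) module set)"
    proof (intro equalityI subsetI)
      fix A assume "A \<in> (\<lambda>c. quotient_algebra KQ (array_ideal Q R T c :: (_ \<Rightarrow> 'k) set)) ` V Q R T"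
      then obtain c where c: "c \<in> V Q R T"
          "A = quotient_algebra KQ (array_ideal Q R T c :: (_ \<Rightarrow> 'k) set)" by blast
      have "ideal (array_ideal Q R T c) KQ"
        using c(1) assms(3) by (intro array_ideal_ideal) (auto simp: V_def)
      moreover from this have "I_Mon Q R (array_ideal Q R T c) = monomial_ideal Q T"
        using I_Mon_min_tips V_min_tips[OF c(1) assms(3)] by metis
      ultimately show "A \<in> Alg Q R T" using c(2) unfolding Alg_def by blast
    next
      fix A assume "A \<in> (Alg Q R T :: ('k, (('v, 'a) qpath \<Rightarrow> 'k) set) module set)"
      then obtain I :: "(('v, 'a) qpath \<Rightarrow> 'k) set" where
          I: "ideal I KQ" "I_Mon Q R I = monomial_ideal Q T" "A = quotient_algebra KQ I"
        unfolding Alg_def by blast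
      then obtain c where "c \<in> V Q R T" "array_ideal Q R T c = I"
        using V_array_exists[OF I(1) assms(3) I(2) antichain] by blast
      then show "A \<in> (\<lambda>c. quotient_algebra KQ (array_ideal Q R T c)) ` V Q R T"
        using I(3) by blast
    qed
  qed
qed

end
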